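(* Let $\hat B\in\hat{\mathcal K}_c$ and let $h=\hat{\mathbb E}[\mathbf h(\hat B)]\in\mathbb R^2$. Assume that $\hat{\mathbb P}\{\hat\omega:\mathbf h(\hat B,\hat\omega)=h\}=1$. Then there exists a forward measurable cocycle $B\in\mathcal K_c^+$ defined on the canonical space $\Omega$ such that $\hat B(\hat\omega)=B(\omega(\hat\omega))$ (that is, $\hat B(\hat\omega,x,y)=B(\omega(\hat\omega),x,y)$ for all $x,y\in\mathbb Z^2$) for $\hat{\mathbb P}$-almost every $\hat\omega$.
   Context: Extended space. $(\hat\Omega,\hat{\mathfrak S},\hat{\mathbb P})$ is a Polish probability space with a group of continuous bijections $\hat T=\{\hat T_x:x\in\mathbb Z^2\}$ of $\hat\Omega$ onto itself ($\hat T_0$ is the identity, $\hat T_x\hat T_y=\hat T_{x+y}$); $\hat{\mathbb P}$ is invariant under every $\hat T_x$; $\hat{\mathbb E}$ is its expectation; $\hat{\mathcal I}$ is the $\sigma$-algebra of events invariant under the group $\hat T$. There are given random variables $\omega_x:\hat\Omega\to\mathbb R$, $x\in\mathbb Z^2$, with $\omega_x(\hat T_z\hat\omega)=\omega_{x+z}(\hat\omega)$ almost surely, which are i.i.d. under $\hat{\mathbb P}$ with $\hat{\mathbb E}[|\omega_0|^{2+\epsilon}]<\infty$ for some $\epsilon>0$ and $\hat{\mathbb E}[\omega_0^2]>\hat{\mathbb E}[\omega_0]^2$. Canonical space. $\Omega=\mathbb R^{\mathbb Z^2}$ with its Borel $\sigma$-algebra $\mathcal F$, generic element $\omega=(\omega_x)_{x\in\mathbb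 Z^2}$, shifts $(T_z\omega)_x=\omega_{x+z}$. The map $\hat\omega\mapsto\omega(\hat\omega)=(\omega_x(\hat\omega))_{x\in\mathbb Z^2}$ goes from $\hat\Omega$ to $\Omega$, and $\mathbb P$ is the push-forward of $\hat{\mathbb P}$ under it, an i.i.d. product measure with expectation $\mathbb E$. For $u\in\mathbb Z^2$, $\mathcal F_u^+$ is the $\sigma$-algebra generated by $\{\omega_y:y-u\in\mathbb Z_+^2\}$, with $\mathbb Z_+=\{0,1,2,\dots\}$. Cocycles. $e_1=(1,0)$, $e_2=(0,1)$. A function $b:\mathbb Z^2\times\mathbb Z^2\to\mathbb R$ is a cocycle if $b(x,y)+b(y,z)=b(x,z)$ for all $x,y,z$; it recovers the weights $\omega$ if $\min\{b(x,x+e_1),b(x,x+e_2)\}=\omega_x$ for all $x$. $\hat{\mathcal K}$ is the collection of measurable functions $\hat B:\hat\Omega\times\mathbb Z^2\times\mathbb Z^2\to\mathbb R$ such that: $\hat{\mathbb P}$-a.s. $\hat B(\hat\omega,\cdot,\cdot)$ is a cocycle recovering $\omega(\hat\omega)$; $\hat{\mathbb P}$-a.s. $\hat B(\hat\omega,x+z,y+z)=\hat B(\hat T_z\hat\omega,x,y)$ for all $x,y,z$ (shift-covariance); and $\hat{\mathbb E}[|\hat B(x,y)|]<\infty$ for all $x,y$. For $\hat B\in\hat{\mathcal K}$ the random vector $\mathbf h(\hat B)=\mathbf h(\hat B,\hat\omega)\in\mathbb R^2$ is defined by $\mathbf h(\hat B)\cdot e_i=-\hat{\mathbb E}[\hat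 B(0,e_i)\mid\hat{\mathcal I}]$, $i\in\{1,2\}$. Cocycle geodesics and coalescence. For $u\in\mathbb Z^2$ let $x^{\hat B,u}(\hat\omega)$ be the semi-infinite path started at $u$ which from each visited site $x$ steps to $x+e_1$ if $\hat B(\hat\omega,x,x+e_1)\le\hat B(\hat\omega,x,x+e_2)$ and to $x+e_2$ otherwise. Up-right paths are indexed by antidiagonal level, $\pi_i\cdot(e_1+e_2)=i$; two semi-infinite up-right paths coalesce if they agree at all sufficiently large levels. $\hat{\mathcal K}_c\subset\hat{\mathcal K}$ is the set of those $\hat B$ for which, $\hat{\mathbb P}$-a.s., $x^{\hat B,u}$ and $x^{\hat B,v}$ coalesce for all $u,v\in\mathbb Z^2$. $\mathcal K$ and $\mathcal K_c$ are the analogous sets of cocycles on the canonical space (replace $(\hat\Omega,\hat{\mathfrak S},\hat{\mathbb P},\hat T)$ by $(\Omega,\mathcal F,\mathbb P,T)$ and $\omega(\hat\omega)$ by $\omega$). $B\in\mathcal K$ is forward measurable if for all $u\in\mathbb Z^2$ and all $x,y\in u+\mathbb Z_+^2$ the map $\omega\mapsto B(\omega,x,y)$ is $\mathcal F_u^+$-measurable. $\mathcal K^+$ is the set of forward measurable elements of $\mathcal K$, and $\mathcal K_c^+=\mathcal K_c\cap\mathcal K^+$. *)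

theory Defs
  imports "HOL-Probability.Probability"
begin

type_synonym site = "int \<times> int"

abbreviation e1 :: site where "e1 \<equiv> (1, 0)"
abbreviation e2 :: site where "e2 \<equiv> (0, 1)"

text \<open>
  Extended space. Every Polish space is a type of class \<^class>\<open>polish_space\<close> for a suitable choice of
  compatible complete metric; the metric itself is used nowhere below, only the topology and its
  Borel sets.
\<close>

locale extended_space = prob_space M
  for M :: "'a::polish_space measure" +
  fixes T :: "site \<Rightarrow> 'a \<Rightarrow> 'a"
    and W :: "site \<Rightarrow> 'a \<Rightarrow> real"
  assumes sets_M: "sets M = sets borel"
    and T_continuous: "\<And>z. continuous_on UNIV (T z)"
    and T_bij: "\<And>z. bij (T z)"
    and T_zero: "T 0 = id"
    and T_add: "\<And>x y. T x \<circ> T y = T (x + y)"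
    and T_invariant: "\<And>z. distr M M (T z) = M"
    and W_measurable: "\<And>x. W x \<in> borel_measurable M"
    and W_shift: "\<And>x z. AE w in M. W x (T z w) = W (x + z) w"
    and W_indep: "indep_vars (\<lambda>_. borel) W UNIV"
    and W_ident: "\<And>x. distr M borel (W x) = distr M borel (W 0)"
    and W_moment: "\<exists>\<epsilon>>0. integrable M (\<lambda>w. \<bar>W 0 w\<bar> powr (2 + \<epsilon>))"
    and W_nondegenerate: "expectation (\<lambda>w. (W 0 w)\<^sup>2) > (expectation (W 0))\<^sup>2"

definition cocycle :: "(site \<Rightarrow> site \<Rightarrow> real) \<Rightarrow> bool" where
  "cocycle b \<longleftrightarrow> (\<forall>x y z. b x y + b y z = b x z)"

definition recovers :: "(site \<Rightarrow> site \<Rightarrow> real) \<Rightarrow> (site \<Rightarrow> real) \<Rightarrow> bool" where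
  "recovers b \<omega> \<longleftrightarrow> (\<forall>x. min (b x (x + e1)) (b x (x + e2)) = \<omega> x)"

text \<open>
  The cocycle classes are defined for an arbitrary measure \<open>M\<close>, shifts \<open>T\<close> and weights \<open>W\<close>, so that
  the same definitions serve the extended space and the canonical space.
\<close>

definition cocycles ::
  "'a measure \<Rightarrow> (site \<Rightarrow> 'a \<Rightarrow> 'a) \<Rightarrow> (site \<Rightarrow> 'a \<Rightarrow> real) \<Rightarrow> ('a \<Rightarrow> site \<Rightarrow> site \<Rightarrow> real) set" where
  "cocycles M T W = {B.
     (\<lambda>(w, x, y). B w x y) \<in> borel_measurable (M \<Otimes>\<^sub>M count_space UNIV \<Otimes>\<^sub>M count_space UNIV) \<and>
     (AE w in M. cocycle (B w) \<and> recovers (B w) (\<lambda>x. W x w)) \<and>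
     (AE w in M. \<forall>x y z. B w (x + z) (y + z) = B (T z w) x y) \<and>
     (\<forall>x y. integrable M (\<lambda>w. B w x y))}"

definition invariant_algebra :: "'a measure \<Rightarrow> (site \<Rightarrow> 'a \<Rightarrow> 'a) \<Rightarrow> 'a measure" where
  "invariant_algebra M T = sigma (space M) {A \<in> sets M. \<forall>z. T z -` A \<inter> space M = A}"

definition mean_vec ::
  "'a measure \<Rightarrow> (site \<Rightarrow> 'a \<Rightarrow> 'a) \<Rightarrow> ('a \<Rightarrow> site \<Rightarrow> site \<Rightarrow> real) \<Rightarrow> 'a \<Rightarrow> real \<times> real" where
  "mean_vec M T B w =
     (- real_cond_exp M (invariant_algebra M T) (\<lambda>w. B w 0 e1) w,
      - real_cond_exp M (invariant_algebra M T) (\<lambda>w. B w 0 e2) w)"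

definition level :: "site \<Rightarrow> int" where
  "level x = fst x + snd x"

definition geo_step :: "(site \<Rightarrow> site \<Rightarrow> real) \<Rightarrow> site \<Rightarrow> site" where
  "geo_step b x = (if b x (x + e1) \<le> b x (x + e2) then x + e1 else x + e2)"

text \<open>
  The site at antidiagonal level \<open>n\<close> of the cocycle geodesic from \<open>u\<close>. It is meaningful for
  \<open>n \<ge> level u\<close>; for smaller \<open>n\<close> it takes the junk value \<open>u\<close>, which does not affect coalescence.
\<close>

definition geodesic :: "(site \<Rightarrow> site \<Rightarrow> real) \<Rightarrow> site \<Rightarrow> int \<Rightarrow> site" where
  "geodesic b u n = (geo_step b ^^ nat (n - level u)) u"

definition coalesce :: "(int \<Rightarrow> site) \<Rightarrow> (int \<Rightarrow> site) \<Rightarrow> bool" where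
  "coalesce p q \<longleftrightarrow> (\<exists>N. \<forall>n\<ge>N. p n = q n)"

definition coalescing_cocycles ::
  "'a measure \<Rightarrow> (site \<Rightarrow> 'a \<Rightarrow> 'a) \<Rightarrow> (site \<Rightarrow> 'a \<Rightarrow> real) \<Rightarrow> ('a \<Rightarrow> site \<Rightarrow> site \<Rightarrow> real) set" where
  "coalescing_cocycles M T W =
     {B \<in> cocycles M T W. AE w in M. \<forall>u v. coalesce (geodesic (B w) u) (geodesic (B w) v)}"

text \<open>
  Canonical space: the type \<^typ>\<open>site \<Rightarrow> real\<close> with the Borel sets of its product topology.
\<close>

definition canonical_measure :: "'a measure \<Rightarrow> (site \<Rightarrow> 'a \<Rightarrow> real) \<Rightarrow> (site \<Rightarrow> real) measure" where
  "canonical_measure M W = distr M borel (\<lambda>w x. W x w)"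

definition canonical_shift :: "site \<Rightarrow> (site \<Rightarrow> real) \<Rightarrow> (site \<Rightarrow> real)" where
  "canonical_shift z \<omega> = (\<lambda>x. \<omega> (x + z))"

definition canonical_weight :: "site \<Rightarrow> (site \<Rightarrow> real) \<Rightarrow> real" where
  "canonical_weight x \<omega> = \<omega> x"

definition quadrant :: "site \<Rightarrow> site set" where
  "quadrant u = {y. fst u \<le> fst y \<and> snd u \<le> snd y}"

definition forward_algebra :: "site \<Rightarrow> (site \<Rightarrow> real) measure" where
  "forward_algebra u =
     sigma UNIV {canonical_weight y -` A | y A. y \<in> quadrant u \<and> A \<in> sets borel}"

definition forward_measurable :: "((site \<Rightarrow> real) \<Rightarrow> site \<Rightarrow> site \<Rightarrow> real) \<Rightarrow> bool" where
  "forward_measurable B \<longleftrightarrow>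
     (\<forall>u. \<forall>x\<in>quadrant u. \<forall>y\<in>quadrant u. (\<lambda>\<omega>. B \<omega> x y) \<in> borel_measurable (forward_algebra u))"

definition forward_cocycles ::
  "(site \<Rightarrow> real) measure \<Rightarrow> ((site \<Rightarrow> real) \<Rightarrow> site \<Rightarrow> site \<Rightarrow> real) set" where
  "forward_cocycles P = {B \<in> cocycles P canonical_shift canonical_weight. forward_measurable B}"

definition forward_coalescing_cocycles ::
  "(site \<Rightarrow> real) measure \<Rightarrow> ((site \<Rightarrow> real) \<Rightarrow> site \<Rightarrow> site \<Rightarrow> real) set" where
  "forward_coalescing_cocycles P =
     coalescing_cocycles P canonical_shift canonical_weight \<inter> forward_cocycles P"

end

theory Submission
  imports Defs
begin

text \<open>
  The argument compares two coalescing cocycles \<open>b\<close> and \<open>b'\<close> that recover the same weights. Since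
  the lattice is planar, geodesics of \<open>b\<close> and of \<open>b'\<close> that change sides must meet, and cocycle
  geodesics maximise passage times; so one of the two cocycles dominates the other
  simultaneously on all horizontal (and, in the opposite sense, on all vertical) edges
  (\<open>increments_ordered\<close>). Two ordered cocycles with the same mean increments coincide. This is used twice.

  First, given the weights, draw a second copy \<open>b'\<close> of the cocycle \<open>b\<close> from its conditional law,
  independently of \<open>b\<close> (\<open>conditional_coupling\<close>). The pair is shift-invariant, the event that \<open>b'\<close> dominates \<open>b\<close> is
  invariant, and on an invariant event the mean increment is the deterministic vector \<open>-h\<close> times
  the probability of the event, for both copies. Hence \<open>b = b'\<close> almost surely
  (\<open>edges_eq_of_ordered_coupling\<close>), and a random variable that equals its conditionally independent copy is a function of the
  conditioning variable: \<open>Bh = F \<omega>\<close> (\<open>cocycle_function_of_weights\<close>). The hypothesis that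
  the mean vector of \<open>Bh\<close> is almost surely constant is what makes the two means agree on every
  invariant event.

  Secondly, on the product space, resample all weights outside a half-plane \<open>H\<close> with boundary direction \<open>e'\<close>
  and inner normal \<open>e\<close>, and compare \<open>b = F(\<omega>)\<close> with \<open>b' = F(\<omega>')\<close>. The weights agree
  on \<open>H\<close>, so the \<open>e'\<close>-increments of \<open>b\<close> and \<open>b'\<close> are ordered on \<open>H\<close>. By the cocycle property and invariance along
  \<open>e'\<close>, the mean difference of the \<open>e'\<close>-increments, restricted to the ordering event, does not change when the edge moves in
  direction \<open>e\<close>; it tends to \<open>0\<close> because far inside \<open>H\<close> the resampled weights are not seen
  (\<open>resample_approximates\<close>). So the \<open>e'\<close>-increments agree on \<open>H\<close>. If some \<open>e\<close>-increment
  differed, then it would differ by the same amount along a whole line in direction \<open>e'\<close>, and the geodesics of one of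
  the cocycles would run along that line forever, which contradicts coalescence
  (\<open>eq_of_transverse_increments_eq\<close>). Thus \<open>F\<close> restricted to \<open>H\<close> ignores the weights outside \<open>H\<close>
  (\<open>resample_invariance_half_plane\<close>). A quadrant is the intersection of a
  vertical and a horizontal half-plane; resampling off both, and freezing the resampled weights at suitable values,
  gives an exactly forward measurable version of \<open>F\<close> (\<open>quadrant_version\<close>).
\<close>

section \<open>Geodesics of coalescing cocycles\<close>

text \<open>
  The action of the shifts on functions of two sites, written so that shift-covariance of \<open>B\<close> reads
  \<open>B(T_z w) =\<close> \<open>translate z (B w)\<close>.
\<close>

definition translate :: "site \<Rightarrow> (site \<Rightarrow> site \<Rightarrow> real) \<Rightarrow> site \<Rightarrow> site \<Rightarrow> real" where
  "translate z b = (\<lambda>x y. b (x + z) (y + z))"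

text \<open>
  The weights that \<open>b\<close> recovers.
\<close>

definition weight_of :: "(site \<Rightarrow> site \<Rightarrow> real) \<Rightarrow> site \<Rightarrow> real" where
  "weight_of b x = min (b x (x + e1)) (b x (x + e2))"

text \<open>
  A cocycle whose geodesics coalesce pairwise. Unlike the membership in
  \<^const>\<open>coalescing_cocycles\<close> this is a property of a single realisation.
\<close>

definition coalescing :: "(site \<Rightarrow> site \<Rightarrow> real) \<Rightarrow> bool" where
  "coalescing b \<longleftrightarrow> cocycle b \<and> (\<forall>u v. coalesce (geodesic b u) (geodesic b v))"

text \<open>
  Sets that no up-right path can leave.
\<close>

definition up_closed :: "site set \<Rightarrow> bool" where
  "up_closed H \<longleftrightarrow> (\<forall>x\<in>H. x + e1 \<in> H \<and> x + e2 \<in> H)"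

lemma cocycle_add: "cocycle b \<Longrightarrow> b x z = b x y + b y z"
  unfolding cocycle_def by metis

lemma cocycle_self: "cocycle b \<Longrightarrow> b x x = 0"
  using cocycle_add[of b x x x] by simp

lemma cocycle_swap: "cocycle b \<Longrightarrow> b y x = - b x y"
  using cocycle_add[of b x x y] cocycle_self[of b x] by simp

lemma geo_step_weight: "b x (geo_step b x) = weight_of b x"
  by (auto simp: geo_step_def weight_of_def)

lemma weight_le_edge: "weight_of b x \<le> b x (geo_step b' x)"
  by (auto simp: geo_step_def weight_of_def)

lemma geodesic_start: "geodesic b u (level u) = u"
  by (simp add: geodesic_def)

lemma geodesic_Suc:
  assumes "level u \<le> n"
  shows "geodesic b u (n + 1) = geo_step b (geodesic b u n)"
proof -
  have "nat (n + 1 - level u) = Suc (nat (n - level u))" using assms by simp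
  then show ?thesis by (simp add: geodesic_def)
qed

lemma level_geo_step: "level (geo_step b x) = level x + 1"
  by (simp add: geo_step_def level_def)

lemma level_funpow: "level ((geo_step b ^^ n) u) = level u + int n"
  by (induction n) (auto simp: level_geo_step)

lemma level_geodesic: "level u \<le> n \<Longrightarrow> level (geodesic b u n) = n"
  by (simp add: geodesic_def level_funpow)

lemma fst_geo_step: "fst x \<le> fst (geo_step b x)" "fst (geo_step b x) \<le> fst x + 1"
  by (auto simp: geo_step_def)

lemma funpow_geo_step_in: "up_closed H \<Longrightarrow> x \<in> H \<Longrightarrow> (geo_step b ^^ n) x \<in> H"
  by (induction n) (auto simp: up_closed_def geo_step_def)

text \<open>
  Along its own geodesics a cocycle collects exactly the weights, while along any up-right path
  it collects at least the weights. Hence, among the cocycles with the same weights, each one is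
  minimal along its own geodesics.
\<close>

lemma geodesic_optimal:
  assumes "cocycle b" "cocycle b'" "up_closed H" "x \<in> H"
    and "\<And>y. y \<in> H \<Longrightarrow> weight_of b y = weight_of b' y"
  shows "b x (geodesic b x n) \<le> b' x (geodesic b x n)"
proof -
  have "b x ((geo_step b ^^ k) x) \<le> b' x ((geo_step b ^^ k) x)" for k
  proof (induction k)
    case 0
    then show ?case using assms by (simp add: cocycle_self)
  next
    case (Suc k)
    let ?y = "(geo_step b ^^ k) x"
    have "?y \<in> H" using assms funpow_geo_step_in by blast
    then have "b ?y (geo_step b ?y) \<le> b' ?y (geo_step b ?y)"
      using assms(5) weight_le_edge by (simp add: geo_step_weight)
    then show ?case
      using Suc cocycle_add[OF assms(1), of x "geo_step b ?y" ?y] cocycle_add[OF assms(2), of x "geo_step b ?y" ?y]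
      by simp
  qed
  then show ?thesis by (simp add: geodesic_def)
qed

text \<open>
  The crossing argument: at a common point of the \<open>b'\<close>-geodesic from \<open>x\<close> and the \<open>b\<close>-geodesic from
  \<open>y\<close> both cocycles can be compared.
\<close>

lemma increment_le_of_meeting:
  assumes "cocycle b" "cocycle b'" "up_closed H" "x \<in> H" "y \<in> H"
    and w: "\<And>y. y \<in> H \<Longrightarrow> weight_of b y = weight_of b' y"
    and meet: "geodesic b' x n = geodesic b y n"
  shows "b' x y \<le> b x y"
proof -
  let ?c = "geodesic b y n"
  have "b' x ?c \<le> b x ?c"
    using geodesic_optimal[OF assms(2,1,3,4), of n] w meet by simp
  moreover have "b y ?c \<le> b' y ?c"
    using geodesic_optimal[OF assms(1,2,3,5), of n] w by simp
  ultimately show ?thesis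
    using cocycle_add[OF assms(1), of x ?c y] cocycle_add[OF assms(2), of x ?c y] by simp
qed

text \<open>
  Up-right paths that change sides meet, by a discrete intermediate value theorem for the
  difference of first coordinates along antidiagonal levels.
\<close>

lemma geodesics_meet:
  assumes "level u \<le> n0" "level v \<le> n0" "n0 \<le> n1"
    and "fst (geodesic b u n0) \<le> fst (geodesic b' v n0)"
    and "fst (geodesic b' v n1) \<le> fst (geodesic b u n1)"
  shows "\<exists>n\<ge>n0. geodesic b u n = geodesic b' v n"
proof -
  define f where "f i = fst (geodesic b u (n0 + int i)) - fst (geodesic b' v (n0 + int i))" for i
  have "\<forall>i. 0 \<le> i \<and> i < nat (n1 - n0) \<longrightarrow> \<bar>f (Suc i) - f i\<bar> \<le> 1"
  proof (intro allI impI)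
    fix i
    have *: "n0 + int (Suc i) = (n0 + int i) + 1" by simp
    have "geodesic b u (n0 + int (Suc i)) = geo_step b (geodesic b u (n0 + int i))"
      "geodesic b' v (n0 + int (Suc i)) = geo_step b' (geodesic b' v (n0 + int i))"
      unfolding * using assms by (auto intro!: geodesic_Suc)
    then show "\<bar>f (Suc i) - f i\<bar> \<le> 1"
      unfolding f_def
      using fst_geo_step[where x="geodesic b u (n0 + int i)" and b=b] fst_geo_step[where x="geodesic b' v (n0 + int i)" and b=b']
      by (simp add: abs_le_iff)
  qed
  moreover have "f 0 \<le> 0" "0 \<le> f (nat (n1 - n0))"
    using assms by (auto simp: f_def)
  ultimately obtain i where i: "f i = 0"
    using nat_intermed_int_val[of 0 "nat (n1 - n0)" f 0] by auto
  have "level (geodesic b u (n0 + int i)) = level (geodesic b' v (n0 + int i))"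
    using assms by (simp add: level_geodesic)
  with i have "geodesic b u (n0 + int i) = geodesic b' v (n0 + int i)"
    by (auto simp: f_def level_def prod_eq_iff)
  then show ?thesis by (intro exI[of _ "n0 + int i"]) auto
qed

text \<open>
  If the geodesics of \<open>b'\<close> from one site \<open>u\<close> are infinitely often weakly to the right of those of \<open>b\<close>, then by
  coalescence the same holds for geodesics from any two sites. This forces the meetings that
  order all increments on \<open>H\<close>.
\<close>

lemma increments_ordered_if_frequently:
  assumes good: "coalescing b" "coalescing b'" and H: "up_closed H" "u \<in> H"
    and w: "\<And>y. y \<in> H \<Longrightarrow> weight_of b y = weight_of b' y"
    and freq: "\<And>N. \<exists>n\<ge>N. fst (geodesic b u n) \<le> fst (geodesic b' u n)"
    and x: "x \<in> H"
  shows "b' x (x + e1) \<le> b x (x + e1) \<and> b x (x + e2) \<le> b' x (x + e2)"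
proof -
  have co: "cocycle b" "cocycle b'" using good by (auto simp: coalescing_def)
  have xe: "x + e1 \<in> H" "x + e2 \<in> H" using H x by (auto simp: up_closed_def)
  have late: "\<exists>n\<ge>N. fst (geodesic b v n) \<le> fst (geodesic b' v' n)" for v v' N
  proof -
    obtain N1 N2 where N1: "\<And>n. n \<ge> N1 \<Longrightarrow> geodesic b v n = geodesic b u n"
      and N2: "\<And>n. n \<ge> N2 \<Longrightarrow> geodesic b' v' n = geodesic b' u n"
      using good unfolding coalescing_def coalesce_def by metis
    from freq[of "max N (max N1 N2)"] show ?thesis using N1 N2 by auto
  qed
  have lev: "level (x + e1) = level x + 1" "level (x + e2) = level x + 1" by (auto simp: level_def)
  have st: "geodesic c x (level x + 1) = geo_step c x" for c
    using geodesic_Suc[of x "level x" c] by (simp add: geodesic_start)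
  have st': "geodesic c (x + e1) (level x + 1) = x + e1" "geodesic c (x + e2) (level x + 1) = x + e2" for c
    using geodesic_start[of c "x + e1"] geodesic_start[of c "x + e2"] lev by simp_all
  obtain n1 where n1: "n1 \<ge> level x + 1" "fst (geodesic b (x + e1) n1) \<le> fst (geodesic b' x n1)"
    using late by blast
  obtain n where "geodesic b' x n = geodesic b (x + e1) n"
    using geodesics_meet[of x "level x + 1" "x + e1" n1 b' b] n1 st st' lev fst_geo_step(2)[where x=x and b=b']
    by auto
  from increment_le_of_meeting[OF co H(1) x xe(1) w this]
  have 1: "b' x (x + e1) \<le> b x (x + e1)" .
  obtain n2 where n2: "n2 \<ge> level x + 1" "fst (geodesic b x n2) \<le> fst (geodesic b' (x + e2) n2)"
    using late by blast
  obtain n' where "geodesic b' (x + e2) n' = geodesic b x n'"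
    using geodesics_meet[of "x + e2" "level x + 1" x n2 b' b] n2 st st' lev fst_geo_step(1)[where x=x and b=b]
    by auto
  from increment_le_of_meeting[OF co(2,1) H(1) x xe(2) w[symmetric] this[symmetric]]
  have 2: "b x (x + e2) \<le> b' x (x + e2)" .
  from 1 2 show ?thesis by blast
qed

lemma increments_ordered:
  assumes good: "coalescing b" "coalescing b'" and H: "up_closed H"
    and w: "\<And>y. y \<in> H \<Longrightarrow> weight_of b y = weight_of b' y"
    and e: "e = e1 \<or> e = e2"
  shows "(\<forall>x\<in>H. b x (x + e) \<le> b' x (x + e)) \<or> (\<forall>x\<in>H. b' x (x + e) \<le> b x (x + e))"
proof (cases "H = {}")
  case False
  then obtain u where u: "u \<in> H" by blast
  show ?thesis
  proof (cases "\<forall>N. \<exists>n\<ge>N. fst (geodesic b u n) \<le> fst (geodesic b' u n)")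
    case True
    then show ?thesis using increments_ordered_if_frequently[OF good H u w] e by blast
  next
    case False
    then obtain N where N: "\<And>n. n \<ge> N \<Longrightarrow> fst (geodesic b' u n) \<le> fst (geodesic b u n)"
      by (metis linorder_not_le less_imp_le)
    have "\<exists>n\<ge>k. fst (geodesic b' u n) \<le> fst (geodesic b u n)" for k
      using N[of "max N k"] by (intro exI[of _ "max N k"]) auto
    then show ?thesis using increments_ordered_if_frequently[OF good(2,1) H u w[symmetric]] e by blast
  qed
qed auto


text \<open>
  Integer multiples of a site.
\<close>

definition scale :: "int \<Rightarrow> site \<Rightarrow> site" where
  "scale k e = (k * fst e, k * snd e)"

text \<open>
  A geodesic that is a straight half-line never meets the geodesic that starts beside it, one
  step ahead in the other direction.
\<close>

lemma straight_not_coalescing: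
  assumes e: "(e, e') = (e1, e2) \<or> (e, e') = (e2, e1)"
    and straight: "\<And>k::nat. geo_step b (x + scale k e') = x + scale k e' + e'"
  shows "\<not> coalescing b"
proof
  assume "coalescing b"
  then obtain N where N: "\<And>n. n \<ge> N \<Longrightarrow> geodesic b x n = geodesic b (x + e) n"
    unfolding coalescing_def coalesce_def by metis
  have 1: "(geo_step b ^^ k) x = x + scale k e'" for k
  proof (induction k)
    case (Suc k)
    have "x + scale (int k) e' + e' = x + scale (int (Suc k)) e'"
      by (simp add: scale_def prod_eq_iff algebra_simps)
    with Suc straight[of k] show ?case by simp
  qed (simp add: scale_def prod_eq_iff)
  define g where "g y = fst e * fst y + snd e * snd y" for y :: site
  have "g (x + e) \<le> g ((geo_step b ^^ k) (x + e))" for k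
  proof (induction k)
    case (Suc k)
    have "g y \<le> g (geo_step b y)" for y
      using e by (auto simp: geo_step_def g_def)
    with Suc show ?case by (metis funpow.simps(2) comp_apply order_trans)
  qed simp
  moreover have "g (x + e) = g x + 1" using e by (auto simp: g_def)
  ultimately have 2: "g x + 1 \<le> g ((geo_step b ^^ k) (x + e))" for k by simp
  have 3: "g (x + scale k e') = g x" for k
    using e by (auto simp: g_def scale_def)
  define n where "n = max N (level x + 1)"
  have "g (geodesic b x n) = g x" unfolding geodesic_def 1 by (rule 3)
  moreover have "g x + 1 \<le> g (geodesic b (x + e) n)" unfolding geodesic_def by (rule 2)
  ultimately show False using N[of n] by (simp add: n_def)
qed

text \<open>
  The half-planes used here have the form \<open>{x. c \<le> fst e * fst x + snd e * snd x}\<close>, where \<open>e\<close> is the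
  inner normal and \<open>e'\<close>, the other unit vector, is the direction of the boundary. In such a set, a site is
  joined to any site with a larger or equal \<open>e\<close>-coordinate by \<open>e\<close>-steps followed by \<open>e'\<close>-steps in either sense.
\<close>

lemma cocycle_eq_if_edges_eq:
  assumes co: "cocycle b" "cocycle b'"
    and e: "(e, e') = (e1, e2) \<or> (e, e') = (e2, e1)"
    and H: "H = {x. c \<le> fst e * fst x + snd e * snd x} \<or> H = UNIV"
    and edges: "\<And>x. x \<in> H \<Longrightarrow> b x (x + e) = b' x (x + e)" "\<And>x. x \<in> H \<Longrightarrow> b x (x + e') = b' x (x + e')"
    and xy: "x \<in> H" "y \<in> H"
  shows "b x y = b' x y"
proof -
  define D where "D x y = b x y - b' x y" for x y
  have D: "cocycle D" using co by (auto simp: cocycle_def D_def algebra_simps)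
  have DE: "D x (x + e) = 0" "D x (x + e') = 0" if "x \<in> H" for x
    using edges[OF that] by (auto simp: D_def)
  have inH: "x + scale k e \<in> H" "x + scale j e' \<in> H" if "x \<in> H" "k \<ge> 0" for x k j
    using that e H by (auto simp: scale_def)
  have right: "D x (x + scale (int k) e) = 0" if "x \<in> H" for x k
  proof (induction k)
    case (Suc k)
    have *: "x + scale (int (Suc k)) e = (x + scale (int k) e) + e"
      by (simp add: scale_def prod_eq_iff algebra_simps)
    show ?case unfolding * using Suc DE(1)[OF inH(1)[OF that, of "int k"]] cocycle_add[OF D, of x "x + scale (int k) e + e" "x + scale (int k) e"] by simp
  qed (simp add: scale_def cocycle_self[OF D] flip: zero_prod_def)
  have up: "D x (x + scale (int k) e') = 0" if "x \<in> H" for x k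
  proof (induction k)
    case (Suc k)
    have *: "x + scale (int (Suc k)) e' = (x + scale (int k) e') + e'"
      by (simp add: scale_def prod_eq_iff algebra_simps)
    show ?case unfolding * using Suc DE(2)[OF inH(2)[OF that, of 0 "int k"]] cocycle_add[OF D, of x "x + scale (int k) e' + e'" "x + scale (int k) e'"] by simp
  qed (simp add: scale_def cocycle_self[OF D] flip: zero_prod_def)
  have up': "D x (x + scale k e') = 0" if "x \<in> H" for x k
  proof (cases "k \<ge> 0")
    case True then show ?thesis using up[OF that, of "nat k"] by simp
  next
    case False
    have "x + scale k e' + scale (int (nat (-k))) e' = x"
      using False by (simp add: scale_def prod_eq_iff algebra_simps)
    with up[OF inH(2)[OF that order_refl, of k], of "nat (-k)"] have "D (x + scale k e') x = 0" by metis
    then show ?thesis using cocycle_swap[OF D, of x "x + scale k e'"] by simp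
  qed
  define p where "p z = fst e * fst z + snd e * snd z" for z :: site
  define p' where "p' z = fst e' * fst z + snd e' * snd z" for z :: site
  have main: "D x y = 0" if "x \<in> H" "y \<in> H" "p x \<le> p y" for x y
  proof -
    have *: "y = x + scale (int (nat (p y - p x))) e + scale (p' y - p' x) e'"
      using e that(3) by (auto simp: p_def p'_def scale_def prod_eq_iff)
    show ?thesis
      using right[OF that(1), of "nat (p y - p x)"]
        up'[OF inH(1)[OF that(1), of "int (nat (p y - p x))"], of "p' y - p' x", folded *]
        cocycle_add[OF D, of x y "x + scale (int (nat (p y - p x))) e"] by simp
  qed
  have "D x y = 0"
    using main[OF xy] main[OF xy(2,1)] cocycle_swap[OF D, of x y] by (cases "p x \<le> p y") auto
  then show ?thesis by (simp add: D_def)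
qed

text \<open>
  If the increments along the boundary direction agree, then the difference of the \<open>e\<close>-increments is
  constant along each line in direction \<open>e'\<close>. Where it is nonzero, the cocycle with the larger
  \<open>e\<close>-increment takes only \<open>e'\<close>-steps along the line.
\<close>

lemma eq_of_transverse_increments_eq:
  assumes good: "coalescing b" "coalescing b'"
    and e: "(e, e') = (e1, e2) \<or> (e, e') = (e2, e1)"
    and H: "H = {x. c \<le> fst e * fst x + snd e * snd x}"
    and w: "\<And>y. y \<in> H \<Longrightarrow> weight_of b y = weight_of b' y"
    and eq: "\<And>x. x \<in> H \<Longrightarrow> b x (x + e') = b' x (x + e')"
    and xy: "x \<in> H" "y \<in> H"
  shows "b x y = b' x y"
proof -
  have co: "cocycle b" "cocycle b'" using good by (auto simp: coalescing_def)
  have aux: False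
    if good: "coalescing b" "coalescing b'"
    and w: "\<And>y. y \<in> H \<Longrightarrow> weight_of b y = weight_of b' y"
    and eq: "\<And>x. x \<in> H \<Longrightarrow> b x (x + e') = b' x (x + e')"
    and x: "x \<in> H" "b x (x + e) < b' x (x + e)" for b b' x
  proof -
    have co: "cocycle b" "cocycle b'" using good by (auto simp: coalescing_def)
    define D where "D x y = b' x y - b x y" for x y
    have D: "cocycle D" using co by (auto simp: cocycle_def D_def algebra_simps)
    have inH: "x + scale j e' \<in> H" for j
      using x e H by (auto simp: scale_def)
    have inH': "y + e \<in> H" if "y \<in> H" for y
      using that e H by auto
    have const: "D (x + scale (int k) e') (x + scale (int k) e' + e) = D x (x + e)" for k
    proof (induction k)
      case (Suc k)
      define y where "y = x + scale (int k) e'"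
      have *: "x + scale (int (Suc k)) e' = y + e'"
        by (simp add: y_def scale_def prod_eq_iff algebra_simps)
      have y: "y \<in> H" unfolding y_def by (rule inH)
      have "D y (y + e') = 0" "D (y + e) (y + e + e') = 0"
        using eq[OF y] eq[OF inH'[OF y]] by (auto simp: D_def)
      then have "D (y + e') (y + e' + e) = D y (y + e)"
        using cocycle_add[OF D, of y "y + e' + e" "y + e'"] cocycle_add[OF D, of y "y + e' + e" "y + e"]
        by (simp add: add.assoc add.commute[of e e'])
      with Suc show ?case unfolding * by (simp add: y_def[symmetric])
    qed (simp add: scale_def flip: zero_prod_def)
    have "geo_step b' (x + scale (int k) e') = x + scale (int k) e' + e'" for k
    proof -
      define y where "y = x + scale (int k) e'"
      have y: "y \<in> H" unfolding y_def by (rule inH)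
      have "b y (y + e) < b' y (y + e)" using const[of k] x by (auto simp: D_def y_def)
      moreover have "weight_of b y \<le> b y (y + e)" using e by (auto simp: weight_of_def)
      ultimately have "weight_of b' y < b' y (y + e)" using w[OF y] by simp
      then show ?thesis unfolding y_def[symmetric] using e by (auto simp: weight_of_def geo_step_def)
    qed
    from straight_not_coalescing[OF e this] good show False by blast
  qed
  have "b x (x + e) = b' x (x + e)" if "x \<in> H" for x
    using aux[OF good w eq that] aux[OF good(2,1) w[symmetric] eq[symmetric] that]
    by (meson linorder_neqE_linordered_idom)
  from cocycle_eq_if_edges_eq[OF co e _ this eq xy] H show ?thesis by blast
qed

section \<open>Conditional quantiles and noise outsourcing\<close>

lemma measurable_pred_le_real[measurable (raw)]:
  fixes f g :: "'a \<Rightarrow> real"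
  shows "f \<in> borel_measurable M \<Longrightarrow> g \<in> borel_measurable M \<Longrightarrow> Measurable.pred M (\<lambda>w. f w \<le> g w)"
  unfolding pred_def by (rule borel_measurable_le)

lemma measurable_pred_eq_real[measurable (raw)]:
  fixes f g :: "'a \<Rightarrow> real"
  shows "f \<in> borel_measurable M \<Longrightarrow> g \<in> borel_measurable M \<Longrightarrow> Measurable.pred M (\<lambda>w. f w = g w)"
  unfolding pred_def by (rule borel_measurable_eq)

lemma AE_le_of_nn_integral_le:
  fixes f g :: "'a \<Rightarrow> ennreal"
  assumes [measurable]: "f \<in> borel_measurable P" "g \<in> borel_measurable P"
    and fin: "(\<integral>\<^sup>+x. g x \<partial>P) < \<infinity>"
    and le: "\<And>E. E \<in> sets P \<Longrightarrow> (\<integral>\<^sup>+x. f x * indicator E x \<partial>P) \<le> (\<integral>\<^sup>+x. g x * indicator E x \<partial>P)"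
  shows "AE x in P. f x \<le> g x"
proof -
  define E where "E = {x \<in> space P. g x < f x}"
  have [measurable]: "E \<in> sets P" unfolding E_def by measurable
  have fin': "(\<integral>\<^sup>+x. g x * indicator E x \<partial>P) < \<infinity>"
    by (rule le_less_trans[OF nn_integral_mono fin]) (auto split: split_indicator)
  have "(\<integral>\<^sup>+x. f x * indicator E x - g x * indicator E x \<partial>P)
      = (\<integral>\<^sup>+x. f x * indicator E x \<partial>P) - (\<integral>\<^sup>+x. g x * indicator E x \<partial>P)"
    by (rule nn_integral_diff) (use fin' in \<open>auto split: split_indicator simp: E_def\<close>)
  also have "\<dots> = 0"
    using le[of E] fin' by (simp add: diff_eq_0_iff_ennreal order.strict_trans1)
  finally have "AE x in P. f x * indicator E x - g x * indicator E x = 0"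
    by (subst (asm) nn_integral_0_iff_AE) auto
  with AE_space show ?thesis
  proof eventually_elim
    case (elim x)
    show ?case
    proof (rule ccontr)
      assume n: "\<not> f x \<le> g x"
      with elim have "f x - g x = 0" by (simp add: E_def not_le)
      with n show False by (metis diff_gr0_ennreal less_irrefl not_le)
    qed
  qed
qed

text \<open>
  The Cantor set encoding of a bit sequence as a number in \<open>[0, 1]\<close>. The digits 0 and 2 are used
  so that the bits can be read off by comparison with \<open>1/2\<close>.
\<close>

definition ternary :: "(nat \<Rightarrow> bool) \<Rightarrow> real" where
  "ternary X = (\<Sum>n. of_bool (X n) * 2 * (1 / 3) ^ Suc n)"

text \<open>
  The ternary expansion of \<open>t\<close> shifted by \<open>n\<close> digits, for \<open>t\<close> in the Cantor set; total and Borel for all \<open>t\<close>.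
\<close>

fun residual :: "nat \<Rightarrow> real \<Rightarrow> real" where
  "residual 0 t = t"
| "residual (Suc n) t = 3 * residual n t - 2 * of_bool (1 / 2 < residual n t)"

lemma ternary_summable: "summable (\<lambda>n. of_bool (X n) * 2 * (1 / 3 :: real) ^ Suc n)"
  by (rule summable_comparison_test'[of "\<lambda>n. 2 * (1/3) ^ Suc n"])
     (auto intro!: summable_mult summable_geometric simp: summable_Suc_iff of_bool_def)

lemma ternary_bounds: "0 \<le> ternary X" "ternary X \<le> 1"
proof -
  show "0 \<le> ternary X" unfolding ternary_def by (intro suminf_nonneg ternary_summable) auto
  have s: "(\<lambda>n. 2 * (1/3::real) ^ Suc n) sums 1"
    using sums_mult[OF geometric_sums[of "1/3::real"], of "2/3"] by simp
  have "ternary X \<le> (\<Sum>n. 2 * (1/3::real) ^ Suc n)"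
    unfolding ternary_def
    by (intro suminf_le ternary_summable sums_summable[OF s]) (auto simp: of_bool_def)
  with s show "ternary X \<le> 1" by (simp add: sums_iff)
qed

lemma ternary_rec: "ternary X = of_bool (X 0) * 2 / 3 + ternary (\<lambda>n. X (Suc n)) / 3"
proof -
  have "(\<Sum>n. of_bool (X (Suc n)) * 2 * (1 / 3 :: real) ^ Suc (Suc n)) = ternary X - of_bool (X 0) * 2 / 3"
    unfolding ternary_def using suminf_split_head[OF ternary_summable[of X]] by simp
  moreover have "(\<Sum>n. of_bool (X (Suc n)) * 2 * (1 / 3 :: real) ^ Suc (Suc n)) = ternary (\<lambda>n. X (Suc n)) / 3"
    unfolding ternary_def
    by (subst suminf_divide[symmetric, OF ternary_summable]) simp
  ultimately show ?thesis by simp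
qed

lemma residual_ternary: "residual n (ternary X) = ternary (\<lambda>k. X (n + k))"
proof (induction n)
  case (Suc n)
  show ?case
    using Suc ternary_rec[of "\<lambda>k. X (n + k)"] ternary_bounds[of "\<lambda>k. X (Suc (n + k))"]
    by (auto simp: of_bool_def)
qed simp

lemma ternary_digit: "1 / 2 < residual n (ternary X) \<longleftrightarrow> X n"
  using ternary_rec[of "\<lambda>k. X (n + k)"] ternary_bounds[of "\<lambda>k. X (Suc (n + k))"]
  by (auto simp: residual_ternary of_bool_def)

lemma measurable_residual[measurable]: "residual n \<in> borel_measurable borel"
proof (induction n)
  case 0
  have "residual 0 = (\<lambda>t. t)" by (auto simp: fun_eq_iff)
  then show ?case by simp
next
  case (Suc n)
  have "residual (Suc n) = (\<lambda>t. 3 * residual n t - 2 * (if 1 / 2 < residual n t then 1 else 0))"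
    by (auto simp: fun_eq_iff of_bool_def)
  with Suc show ?case by simp
qed

text \<open>
  A Borel encoding of functions of two sites as real numbers in \<open>[0, 1]\<close>: the bits record all
  comparisons of values with rational numbers. It reduces conditional laws of random cocycles to conditional
  laws of real random variables.
\<close>

definition encode :: "(site \<Rightarrow> site \<Rightarrow> real) \<Rightarrow> real" where
  "encode b = ternary (\<lambda>n. case from_nat n of (x :: site, y :: site, q :: rat) \<Rightarrow> of_rat q < b x y)"

text \<open>
  The Borel left inverse of \<^const>\<open>encode\<close>. The supremum is taken in the extended reals, so that it
  is measurable also at numbers that are not codes.
\<close>

definition decode :: "real \<Rightarrow> site \<Rightarrow> site \<Rightarrow> real" where
  "decode t = (\<lambda>x y. real_of_ereal
     (SUP q :: rat. if 1 / 2 < residual (to_nat (x, y, q)) t then ereal (of_rat q) else - \<infinity>))"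

lemma decode_encode: "decode (encode b) = b"
proof (intro ext)
  fix x y
  have "(SUP q :: rat. if of_rat q < b x y then ereal (of_rat q) else - \<infinity>) = ereal (b x y)" (is "?S = _")
  proof (rule antisym)
    show "ereal (b x y) \<le> ?S"
    proof (rule ccontr)
      assume "\<not> ereal (b x y) \<le> ?S"
      then obtain q where q: "?S < ereal (of_rat q)" "ereal (of_rat q) < ereal (b x y)"
        using ereal_dense3[of ?S "ereal (b x y)"] by (auto simp: not_le)
      from q(2) have "ereal (of_rat q) \<le> ?S"
        by (intro SUP_upper2[of q]) auto
      with q(1) show False by simp
    qed
    show "?S \<le> ereal (b x y)" by (rule SUP_least) auto
  qed
  then show "decode (encode b) x y = b x y"
    unfolding decode_def encode_def ternary_digit from_nat_to_nat prod.case by simp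
qed

lemma measurable_two_site_function:
  fixes f :: "'a \<Rightarrow> site \<Rightarrow> site \<Rightarrow> real"
  assumes "\<And>x y. (\<lambda>w. f w x y) \<in> borel_measurable M"
  shows "f \<in> borel_measurable M"
  by (rule measurable_coordinatewise_then_product, rule measurable_coordinatewise_then_product, rule assms)

lemma measurable_two_site_apply[measurable]:
  "(\<lambda>b :: site \<Rightarrow> site \<Rightarrow> real. b x y) \<in> borel_measurable borel"
  by (rule measurable_compose[OF measurable_product_coordinates measurable_product_coordinates])

lemma measurable_decode[measurable]: "decode \<in> borel_measurable borel"
proof (rule measurable_two_site_function)
  fix x y
  show "(\<lambda>t. decode t x y) \<in> borel_measurable borel"
    unfolding decode_def by measurable
qed

lemma measurable_encode[measurable]: "encode \<in> borel_measurable borel"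
proof -
  have "(\<lambda>b. of_bool (case from_nat n of (x :: site, y :: site, q :: rat) \<Rightarrow> of_rat q < b x y) :: real)
      \<in> borel_measurable (borel :: (site \<Rightarrow> site \<Rightarrow> real) measure)" for n
  proof -
    obtain x y q where "from_nat n = (x :: site, y :: site, q :: rat)" by (metis prod_cases3)
    then show ?thesis by (simp add: of_bool_def) measurable
  qed
  note [measurable] = this
  show ?thesis unfolding encode_def ternary_def by measurable
qed


text \<open>
  The uniform distribution on \<open>[0, 1)\<close>.
\<close>

definition unit_interval :: "real measure" where
  "unit_interval = uniform_measure lborel {0..<1}"

lemma prob_space_unit_interval: "prob_space unit_interval"
  unfolding unit_interval_def by (intro prob_space_uniform_measure) auto

lemma sets_unit_interval[measurable_cong]: "sets unit_interval = sets borel"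
  by (simp add: unit_interval_def)

lemma unit_interval_below:
  assumes "a \<le> 1"
  shows "emeasure unit_interval {u. ennreal u < a} = a"
proof -
  obtain r where r: "a = ennreal r" "0 \<le> r" "r \<le> 1"
    using assms by (cases a) (auto simp: ennreal_le_1 top_unique)
  have "{0..<1} \<inter> {u. ennreal u < a} = {0..<r}"
    using r by (auto simp: ennreal_less_iff)
  moreover have "{u. ennreal u < a} \<in> sets lborel" by simp
  ultimately show ?thesis unfolding unit_interval_def using r by (simp add: divide_ennreal flip: ennreal_1)
qed

lemma finite_measure_pair_eqI:
  assumes sets: "sets \<mu> = sets (R \<Otimes>\<^sub>M N)" "sets \<nu> = sets (R \<Otimes>\<^sub>M N)" and fin: "finite_measure \<mu>"
    and eq: "\<And>A B. A \<in> sets R \<Longrightarrow> B \<in> sets N \<Longrightarrow> emeasure \<mu> (A \<times> B) = emeasure \<nu> (A \<times> B)"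
  shows "\<mu> = \<nu>"
proof (rule measure_eqI_generator_eq[where A="\<lambda>_. space R \<times> space N"])
  show "Int_stable {a \<times> b | a b. a \<in> sets R \<and> b \<in> sets N}" by (rule Int_stable_pair_measure_generator)
  show "{a \<times> b | a b. a \<in> sets R \<and> b \<in> sets N} \<subseteq> Pow (space R \<times> space N)"
    by (rule pair_measure_closed)
  show "\<And>i::nat. emeasure \<mu> (space R \<times> space N) \<noteq> \<infinity>"
    using finite_measure.emeasure_finite[OF fin] by simp
qed (use sets eq in \<open>auto simp: sets_pair_measure\<close>)

lemma finite_measure_pair_real_eqI:
  assumes sets: "sets \<mu> = sets (R \<Otimes>\<^sub>M (borel :: real measure))" "sets \<nu> = sets (R \<Otimes>\<^sub>M (borel :: real measure))"
    and fin: "finite_measure \<mu>"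
    and eq: "\<And>A t. A \<in> sets R \<Longrightarrow> emeasure \<mu> (A \<times> {t<..}) = emeasure \<nu> (A \<times> {t<..})"
  shows "\<mu> = \<nu>"
proof (rule finite_measure_pair_eqI[OF sets fin])
  fix A and B :: "real set" assume A[measurable]: "A \<in> sets R" and B[measurable]: "B \<in> sets borel"
  have sp: "space \<mu> = space R \<times> UNIV" "space \<nu> = space R \<times> UNIV"
    using sets[THEN sets_eq_imp_space_eq] by (auto simp: space_pair_measure)
  note [measurable_cong] = sets
  have emb: "emeasure (distr (density \<kappa> (indicator (A \<times> UNIV))) borel snd) C = emeasure \<kappa> (A \<times> C)"
    if [measurable_cong]: "sets \<kappa> = sets (R \<Otimes>\<^sub>M (borel :: real measure))" and [measurable]: "C \<in> sets borel" for \<kappa> C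
  proof -
    have spk: "space \<kappa> = space R \<times> UNIV"
      using that(1)[THEN sets_eq_imp_space_eq] by (auto simp: space_pair_measure)
    have "emeasure (distr (density \<kappa> (indicator (A \<times> UNIV))) borel snd) C
        = (\<integral>\<^sup>+x. indicator (A \<times> UNIV) x * indicator (snd -` C \<inter> space \<kappa>) x \<partial>\<kappa>)"
      by (subst emeasure_distr) (auto simp: emeasure_density)
    also have "\<dots> = (\<integral>\<^sup>+x. indicator (A \<times> C) x \<partial>\<kappa>)"
      by (intro nn_integral_cong) (auto split: split_indicator)
    finally show ?thesis by simp
  qed
  have "distr (density \<mu> (indicator (A \<times> UNIV))) borel snd = distr (density \<nu> (indicator (A \<times> UNIV))) borel snd"
  proof (rule measure_eqI_lessThan)
    fix t
    show "emeasure (distr (density \<mu> (indicator (A \<times> UNIV))) borel snd) {t<..} < \<infinity>"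
      using finite_measure.emeasure_finite[OF fin] by (simp add: emb[OF sets(1)] less_top[symmetric])
  qed (simp_all add: emb[OF sets(1)] emb[OF sets(2)] eq[OF A])
  then show "emeasure \<mu> (A \<times> B) = emeasure \<nu> (A \<times> B)"
    using emb[OF sets(1) B] emb[OF sets(2) B] by simp
qed

text \<open>
  Noise outsourcing: a random variable \<open>\<xi>\<close> has the same joint law with \<open>\<rho>\<close> as a measurable
  function of \<open>\<rho>\<close> and an independent uniform variable. The function is the conditional quantile: with
  Radon-Nikodym derivatives \<open>F\<^sub>s(\<rho>) = P(\<xi> > s | \<rho>)\<close>, it is the supremum of the rational \<open>s\<close>
  with \<open>u < F\<^sub>s(\<rho>)\<close>.
\<close>

lemma real_noise_outsourcing:
  fixes \<xi> :: "'a \<Rightarrow> real"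
  assumes M: "prob_space M" and \<rho>[measurable]: "\<rho> \<in> measurable M R" and \<xi>[measurable]: "\<xi> \<in> borel_measurable M"
    and \<xi>_bounds: "\<And>w. w \<in> space M \<Longrightarrow> 0 \<le> \<xi> w \<and> \<xi> w \<le> 1"
  shows "\<exists>Q. Q \<in> borel_measurable (R \<Otimes>\<^sub>M borel) \<and>
    distr (distr M R \<rho> \<Otimes>\<^sub>M unit_interval) (R \<Otimes>\<^sub>M borel) (\<lambda>p. (fst p, Q p)) = distr M (R \<Otimes>\<^sub>M borel) (\<lambda>w. (\<rho> w, \<xi> w))"
proof -
  interpret M: prob_space M by fact
  interpret U: prob_space unit_interval by (rule prob_space_unit_interval)
  define P where "P = distr M R \<rho>"
  have [measurable_cong]: "sets P = sets R" by (simp add: P_def)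
  have spP: "space P = space R" by (simp add: P_def)
  interpret P: prob_space P unfolding P_def by (rule M.prob_space_distr) measurable
  interpret PU: pair_prob_space P unit_interval ..
  define \<mu> where "\<mu> s = distr (density M (indicator {w \<in> space M. s < \<xi> w})) R \<rho>" for s :: real
  have \<mu>: "emeasure (\<mu> s) E = emeasure M {w \<in> space M. \<rho> w \<in> E \<and> s < \<xi> w}" if [measurable]: "E \<in> sets R" for s E
  proof -
    have "emeasure (\<mu> s) E = (\<integral>\<^sup>+w. indicator {w \<in> space M. s < \<xi> w} w * indicator (\<rho> -` E \<inter> space M) w \<partial>M)"
      unfolding \<mu>_def by (subst emeasure_distr) (auto simp: emeasure_density)
    also have "\<dots> = (\<integral>\<^sup>+w. indicator {w \<in> space M. \<rho> w \<in> E \<and> s < \<xi> w} w \<partial>M)"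
      by (intro nn_integral_cong) (auto split: split_indicator)
    finally show ?thesis by simp
  qed
  define F where "F s = RN_deriv P (\<mu> s)" for s
  have F_meas[measurable]: "F s \<in> borel_measurable R" for s
    using borel_measurable_RN_deriv[of P "\<mu> s"] unfolding F_def by measurable
  have dens: "density P (F s) = \<mu> s" for s
    unfolding F_def
  proof (rule P.density_RN_deriv)
    show "absolutely_continuous P (\<mu> s)"
      unfolding absolutely_continuous_def
    proof
      fix E assume E: "E \<in> null_sets P"
      then have [measurable]: "E \<in> sets R" by (auto simp: null_sets_def P_def)
      have "emeasure (\<mu> s) E \<le> emeasure M (\<rho> -` E \<inter> space M)"
        unfolding \<mu>[OF \<open>E \<in> sets R\<close>] by (intro emeasure_mono) auto
      also have "\<dots> = emeasure P E" unfolding P_def by (simp add: emeasure_distr)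
      finally show "E \<in> null_sets (\<mu> s)" using E by (auto simp: null_sets_def \<mu>_def)
    qed
  qed (simp add: \<mu>_def P_def)
  have F: "(\<integral>\<^sup>+r. F s r * indicator E r \<partial>P) = emeasure M {w \<in> space M. \<rho> w \<in> E \<and> s < \<xi> w}"
    if [measurable]: "E \<in> sets R" for s E
    using \<mu>[OF that, of s] unfolding dens[symmetric] by (simp add: emeasure_density)
  have F_mono: "AE r in P. F t r \<le> F s r" if "s \<le> t" for s t
  proof (rule AE_le_of_nn_integral_le)
    have "(\<integral>\<^sup>+r. F s r \<partial>P) = (\<integral>\<^sup>+r. F s r * indicator (space R) r \<partial>P)"
      by (intro nn_integral_cong) (auto simp: spP)
    also have "\<dots> < \<infinity>"
      by (subst F) (auto simp: less_top[symmetric])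
    finally show "(\<integral>\<^sup>+r. F s r \<partial>P) < \<infinity>" .
  next
    fix E assume "E \<in> sets P"
    then have [measurable]: "E \<in> sets R" by (simp add: P_def)
    show "(\<integral>\<^sup>+r. F t r * indicator E r \<partial>P) \<le> (\<integral>\<^sup>+r. F s r * indicator E r \<partial>P)"
      unfolding F[OF \<open>E \<in> sets R\<close>] using that by (intro emeasure_mono) auto
  qed measurable
  have F_le_1: "AE r in P. F s r \<le> 1" for s
  proof (rule AE_le_of_nn_integral_le)
    fix E assume "E \<in> sets P"
    then have [measurable]: "E \<in> sets R" by (simp add: P_def)
    have "(\<integral>\<^sup>+r. F s r * indicator E r \<partial>P) \<le> emeasure M (\<rho> -` E \<inter> space M)"
      unfolding F[OF \<open>E \<in> sets R\<close>] by (intro emeasure_mono) auto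
    also have "\<dots> = (\<integral>\<^sup>+r. 1 * indicator E r \<partial>P)"
      using \<open>E \<in> sets P\<close> by (simp add: P_def emeasure_distr)
    finally show "(\<integral>\<^sup>+r. F s r * indicator E r \<partial>P) \<le> (\<integral>\<^sup>+r. 1 * indicator E r \<partial>P)" .
  qed (auto simp: P.emeasure_space_1)
  define S where "S t = {q :: rat. -1 \<le> (of_rat q :: real) \<and> (of_rat q :: real) \<le> 1 \<and> t < of_rat q}" for t :: real
  define val where "val p q = (if -1 \<le> (of_rat q :: real) \<and> (of_rat q :: real) \<le> 1 \<and> ennreal (snd p) < F (of_rat q) (fst p)
      then of_rat q else -1 :: real)" for p and q :: rat
  define Q where "Q p = (SUP q. val p q)" for p
  have bdd: "bdd_above (range (val p))" for p
    by (rule bdd_aboveI[of _ 1]) (auto simp: val_def)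
  have val_meas[measurable]: "(\<lambda>p. val p q) \<in> borel_measurable (R \<Otimes>\<^sub>M borel)" for q
    unfolding val_def by measurable
  have Q_meas[measurable]: "Q \<in> borel_measurable (R \<Otimes>\<^sub>M borel)"
    unfolding Q_def using bdd by (intro borel_measurable_cSUP) auto
  \<comment> \<open>The default value \<open>-1\<close> in the supremum never exceeds a level \<open>t \<ge> -1\<close>.\<close>
  have Q_gr: "t < Q (r, u) \<longleftrightarrow> ennreal u < (SUP q\<in>S t. F (of_rat q) r)" if "-1 \<le> t" for t r u
  proof -
    have "t < Q (r, u) \<longleftrightarrow> (\<exists>q. t < val (r, u) q)"
      unfolding Q_def using less_cSUP_iff[OF _ bdd[of "(r, u)"], of t] by simp
    also have "\<dots> \<longleftrightarrow> (\<exists>q\<in>S t. ennreal u < F (of_rat q) r)"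
      using that by (auto simp: val_def S_def split: if_splits)
    finally show ?thesis by (simp add: less_SUP_iff)
  qed
  have key: "emeasure (P \<Otimes>\<^sub>M unit_interval) {p \<in> space (R \<Otimes>\<^sub>M borel). fst p \<in> E \<and> t < Q p}
      = emeasure M {w \<in> space M. \<rho> w \<in> E \<and> t < \<xi> w}" (is "emeasure _ ?X = _")
    if [measurable]: "E \<in> sets R" for E t
  proof (cases "-1 \<le> t")
    case False
    have "-1 \<le> Q p" for p
      unfolding Q_def by (rule cSUP_upper2[OF bdd, of 0]) (auto simp: val_def)
    then have "?X = E \<times> UNIV"
      using False sets.sets_into_space[OF that] by (auto simp: space_pair_measure intro: less_le_trans[of t "-1"])
    moreover have "emeasure (P \<Otimes>\<^sub>M unit_interval) (E \<times> UNIV) = emeasure P E"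
      using U.emeasure_space_1 by (subst U.emeasure_pair_measure_Times) (auto simp: unit_interval_def P_def)
    moreover have "{w \<in> space M. \<rho> w \<in> E \<and> t < \<xi> w} = \<rho> -` E \<inter> space M"
      using False \<xi>_bounds by fastforce
    ultimately show ?thesis by (simp add: P_def emeasure_distr)
  next
    case True
    have X: "?X \<in> sets (P \<Otimes>\<^sub>M unit_interval)" by measurable
    have "emeasure (P \<Otimes>\<^sub>M unit_interval) ?X = (\<integral>\<^sup>+r. emeasure unit_interval (Pair r -` ?X) \<partial>P)"
      by (rule U.emeasure_pair_measure_alt[OF X])
    also have "\<dots> = (\<integral>\<^sup>+r. (SUP q\<in>S t. F (of_rat q) r) * indicator E r \<partial>P)"
    proof (rule nn_integral_cong_AE)
      have "AE r in P. \<forall>q :: rat. F (of_rat q) r \<le> 1"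
        using F_le_1 by (simp add: AE_all_countable)
      with AE_space show "AE r in P. emeasure unit_interval (Pair r -` ?X) = (SUP q\<in>S t. F (of_rat q) r) * indicator E r"
      proof eventually_elim
        case (elim r)
        have "Pair r -` ?X = (if r \<in> E then {u. ennreal u < (SUP q\<in>S t. F (of_rat q) r)} else {})"
          using elim Q_gr[OF True] by (auto simp: space_pair_measure spP)
        then show ?case using elim by (auto simp: unit_interval_below SUP_le_iff)
      qed
    qed
    also have "\<dots> = (\<integral>\<^sup>+r. F t r * indicator E r \<partial>P)"
    proof (rule antisym)
      have "AE r in P. \<forall>q\<in>S t. F (of_rat q) r \<le> F t r"
        using F_mono by (subst AE_ball_countable) (auto simp: S_def less_imp_le)
      then show "(\<integral>\<^sup>+r. (SUP q\<in>S t. F (of_rat q) r) * indicator E r \<partial>P) \<le> (\<integral>\<^sup>+r. F t r * indicator E r \<partial>P)"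
        by (intro nn_integral_mono_AE) (auto elim!: eventually_mono intro!: mult_right_mono SUP_least)
      show "(\<integral>\<^sup>+r. F t r * indicator E r \<partial>P) \<le> (\<integral>\<^sup>+r. (SUP q\<in>S t. F (of_rat q) r) * indicator E r \<partial>P)"
      proof (cases "t < 1")
        case False
        then have "{w \<in> space M. \<rho> w \<in> E \<and> t < \<xi> w} = {}" using \<xi>_bounds by fastforce
        then show ?thesis unfolding F[OF that] by (simp only: emeasure_empty zero_le)
      next
        case t1: True
        have "{w \<in> space M. \<rho> w \<in> E \<and> t < \<xi> w} = (\<Union>n. {w \<in> space M. \<rho> w \<in> E \<and> t + 1 / real (Suc n) < \<xi> w})"
        proof (safe, goal_cases)
          case (1 w)
          obtain n where "inverse (real (Suc n)) < \<xi> w - t" using 1 reals_Archimedean[of "\<xi> w - t"] by auto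
          then show ?case using 1 by (auto simp: inverse_eq_divide intro!: exI[of _ n])
        qed (smt (verit) divide_pos_pos of_nat_0_less_iff zero_less_Suc)
        then have "(\<integral>\<^sup>+r. F t r * indicator E r \<partial>P)
            = (SUP n. emeasure M {w \<in> space M. \<rho> w \<in> E \<and> t + 1 / real (Suc n) < \<xi> w})"
          unfolding F[OF that]
          by (subst SUP_emeasure_incseq)
             (auto simp: incseq_def intro: le_less_trans[rotated] intro!: add_left_mono divide_left_mono)
        also have "\<dots> \<le> (\<integral>\<^sup>+r. (SUP q\<in>S t. F (of_rat q) r) * indicator E r \<partial>P)"
        proof (rule SUP_least)
          fix n
          obtain q where q: "t < of_rat q" "of_rat q < min 1 (t + 1 / real (Suc n))"
            using of_rat_dense[of t "min 1 (t + 1 / real (Suc n))"] t1 by auto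
          have "emeasure M {w \<in> space M. \<rho> w \<in> E \<and> t + 1 / real (Suc n) < \<xi> w} \<le> (\<integral>\<^sup>+r. F (of_rat q) r * indicator E r \<partial>P)"
            unfolding F[OF that] using q by (intro emeasure_mono) auto
          also have "\<dots> \<le> (\<integral>\<^sup>+r. (SUP q\<in>S t. F (of_rat q) r) * indicator E r \<partial>P)"
            using q True by (intro nn_integral_mono mult_right_mono SUP_upper) (auto simp: S_def)
          finally show "emeasure M {w \<in> space M. \<rho> w \<in> E \<and> t + 1 / real (Suc n) < \<xi> w} \<le> \<dots>" .
        qed
        finally show ?thesis .
      qed
    qed
    finally show ?thesis unfolding F[OF that] .
  qed
  have "distr (P \<Otimes>\<^sub>M unit_interval) (R \<Otimes>\<^sub>M borel) (\<lambda>p. (fst p, Q p)) = distr M (R \<Otimes>\<^sub>M borel) (\<lambda>w. (\<rho> w, \<xi> w))"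
  proof (rule finite_measure_pair_real_eqI)
    show "finite_measure (distr (P \<Otimes>\<^sub>M unit_interval) (R \<Otimes>\<^sub>M borel) (\<lambda>p. (fst p, Q p)))"
      by (rule PU.finite_measure_distr) measurable
    fix E t assume E[measurable]: "E \<in> sets R"
    have sp: "space (P \<Otimes>\<^sub>M unit_interval) = space (R \<Otimes>\<^sub>M borel)"
      by (simp add: space_pair_measure spP unit_interval_def)
    have 1: "(\<lambda>p. (fst p, Q p)) -` (E \<times> {t<..}) \<inter> space (P \<Otimes>\<^sub>M unit_interval) = {p \<in> space (R \<Otimes>\<^sub>M borel). fst p \<in> E \<and> t < Q p}"
      unfolding sp by auto
    have 2: "(\<lambda>w. (\<rho> w, \<xi> w)) -` (E \<times> {t<..}) \<inter> space M = {w \<in> space M. \<rho> w \<in> E \<and> t < \<xi> w}" by auto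
    show "emeasure (distr (P \<Otimes>\<^sub>M unit_interval) (R \<Otimes>\<^sub>M borel) (\<lambda>p. (fst p, Q p))) (E \<times> {t<..})
        = emeasure (distr M (R \<Otimes>\<^sub>M borel) (\<lambda>w. (\<rho> w, \<xi> w))) (E \<times> {t<..})"
      by (simp add: emeasure_distr 1 2 key)
  qed simp_all
  with Q_meas show ?thesis unfolding P_def by blast
qed

lemma two_site_noise_outsourcing:
  fixes \<xi> :: "'a \<Rightarrow> site \<Rightarrow> site \<Rightarrow> real"
  assumes M: "prob_space M" and \<rho>[measurable]: "\<rho> \<in> measurable M R" and \<xi>[measurable]: "\<xi> \<in> borel_measurable M"
  shows "\<exists>Q. Q \<in> borel_measurable (R \<Otimes>\<^sub>M borel) \<and>
    distr (distr M R \<rho> \<Otimes>\<^sub>M unit_interval) (R \<Otimes>\<^sub>M borel) (\<lambda>p. (fst p, Q p)) = distr M (R \<Otimes>\<^sub>M borel) (\<lambda>w. (\<rho> w, \<xi> w))"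
proof -
  have "(\<lambda>w. encode (\<xi> w)) \<in> borel_measurable M" by measurable
  moreover have "0 \<le> encode (\<xi> w) \<and> encode (\<xi> w) \<le> 1" for w
    unfolding encode_def by (auto intro: ternary_bounds)
  ultimately obtain Q where Q[measurable]: "Q \<in> borel_measurable (R \<Otimes>\<^sub>M borel)"
    and eq: "distr (distr M R \<rho> \<Otimes>\<^sub>M unit_interval) (R \<Otimes>\<^sub>M borel) (\<lambda>p. (fst p, Q p))
      = distr M (R \<Otimes>\<^sub>M borel) (\<lambda>w. (\<rho> w, encode (\<xi> w)))"
    using real_noise_outsourcing[OF M \<rho>] by blast
  have "distr (distr (distr M R \<rho> \<Otimes>\<^sub>M unit_interval) (R \<Otimes>\<^sub>M borel) (\<lambda>p. (fst p, Q p))) (R \<Otimes>\<^sub>M borel) (\<lambda>p. (fst p, decode (snd p)))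
      = distr (distr M R \<rho> \<Otimes>\<^sub>M unit_interval) (R \<Otimes>\<^sub>M borel) (\<lambda>p. (fst p, decode (Q p)))"
    by (subst distr_distr) (auto simp: comp_def)
  moreover have "distr (distr M (R \<Otimes>\<^sub>M borel) (\<lambda>w. (\<rho> w, encode (\<xi> w)))) (R \<Otimes>\<^sub>M borel) (\<lambda>p. (fst p, decode (snd p)))
      = distr M (R \<Otimes>\<^sub>M borel) (\<lambda>w. (\<rho> w, \<xi> w))"
    by (subst distr_distr) (auto simp: comp_def decode_encode)
  moreover have "(\<lambda>p. decode (Q p)) \<in> borel_measurable (R \<Otimes>\<^sub>M borel)" by measurable
  ultimately show ?thesis using eq by (intro exI[of _ "\<lambda>p. decode (Q p)"]) auto
qed

section \<open>Conditionally independent copies of a cocycle\<close>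

lemma measurable_weight_of[measurable]: "weight_of \<in> borel_measurable borel"
  by (rule measurable_coordinatewise_then_product) (simp add: weight_of_def)

lemma measurable_translate[measurable]: "translate z \<in> borel_measurable borel"
  by (rule measurable_two_site_function) (simp add: translate_def)

lemma measurable_canonical_shift[measurable]: "canonical_shift z \<in> borel_measurable borel"
  by (rule measurable_coordinatewise_then_product) (simp add: canonical_shift_def)

lemma weight_of_translate: "weight_of (translate z b) = canonical_shift z (weight_of b)"
  by (simp add: weight_of_def translate_def canonical_shift_def fun_eq_iff add.commute add.left_commute)

lemma translate_translate: "translate x (translate y b) = translate (x + y) b"
  by (simp add: translate_def fun_eq_iff add.assoc)

lemma translate_0: "translate 0 b = b"
  by (simp add: translate_def)

lemma canonical_shift_shift: "canonical_shift x (canonical_shift y b) = canonical_shift (x + y) b"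
  by (simp add: canonical_shift_def fun_eq_iff add.assoc)

lemma canonical_shift_0: "canonical_shift 0 b = b"
  by (simp add: canonical_shift_def)

lemma measurable_geodesic: "(\<lambda>b. geodesic b u n) \<in> measurable borel (count_space UNIV)"
proof -
  have step: "(\<lambda>b. geo_step b x) \<in> measurable borel (count_space UNIV)" for x
    unfolding geo_step_def by measurable
  have "(\<lambda>b. (geo_step b ^^ k) u) \<in> measurable borel (count_space UNIV)" for k
  proof (induction k)
    case (Suc k)
    then show ?case
      using measurable_compose_countable[of "\<lambda>x b. geo_step b x", OF step] by simp
  qed simp
  then show ?thesis by (simp add: geodesic_def)
qed

lemma measurable_cocycle[measurable]: "Measurable.pred borel cocycle"
  unfolding cocycle_def order.eq_iff by measurable

lemma measurable_coalescing[measurable]: "Measurable.pred borel coalescing"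
proof -
  note [measurable] = measurable_geodesic
  have "Measurable.pred borel (\<lambda>b. geodesic b u n = geodesic b v n)" for u v n
    by measurable
  note [measurable] = this
  show ?thesis unfolding coalescing_def coalesce_def by measurable
qed

text \<open>
  For \<open>b\<close> with law \<open>L\<close> and an independent uniform variable \<open>u\<close>, the copy \<open>Q (weight_of b, u)\<close> is
  conditionally independent of \<open>b\<close> given the weights of \<open>b\<close> and has the same conditional law. The
  pair inherits the shift-invariance of \<open>L\<close>.
\<close>

lemma conditional_coupling:
  fixes L :: "(site \<Rightarrow> site \<Rightarrow> real) measure"
  assumes L: "prob_space L" and setsL[measurable_cong]: "sets L = sets borel"
    and inv: "\<And>z. distr L borel (translate z) = L"
  obtains Q where "Q \<in> borel_measurable (borel \<Otimes>\<^sub>M borel)"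
    and "distr (L \<Otimes>\<^sub>M unit_interval) borel (\<lambda>p. Q (weight_of (fst p), snd p)) = L"
    and "AE p in L \<Otimes>\<^sub>M unit_interval. weight_of (Q (weight_of (fst p), snd p)) = weight_of (fst p)"
    and "\<And>z. distr (L \<Otimes>\<^sub>M unit_interval) (borel \<Otimes>\<^sub>M borel)
                (\<lambda>p. (translate z (fst p), translate z (Q (weight_of (fst p), snd p))))
            = distr (L \<Otimes>\<^sub>M unit_interval) (borel \<Otimes>\<^sub>M borel) (\<lambda>p. (fst p, Q (weight_of (fst p), snd p)))"
proof -
  interpret L: prob_space L by fact
  interpret U: prob_space unit_interval by (rule prob_space_unit_interval)
  interpret LU: pair_prob_space L unit_interval ..
  have spL: "space L = UNIV" using setsL[THEN sets_eq_imp_space_eq] by simp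
  have spU: "space unit_interval = UNIV" by (simp add: unit_interval_def)
  define P where "P = distr L borel weight_of"
  have [measurable_cong]: "sets P = sets borel" by (simp add: P_def)
  interpret P: prob_space P unfolding P_def by (rule L.prob_space_distr) measurable
  have "(\<lambda>b. b) \<in> borel_measurable L" by measurable
  from two_site_noise_outsourcing[OF L _ this, of weight_of borel]
  obtain Q where Q[measurable]: "Q \<in> borel_measurable (borel \<Otimes>\<^sub>M borel)"
    and eq: "distr (P \<Otimes>\<^sub>M unit_interval) (borel \<Otimes>\<^sub>M borel) (\<lambda>p. (fst p, Q p)) = distr L (borel \<Otimes>\<^sub>M borel) (\<lambda>b. (weight_of b, b))"
    by (auto simp: P_def)
  define q where "q p = Q (weight_of (fst p), snd p)" for p
  have [measurable]: "q \<in> borel_measurable (borel \<Otimes>\<^sub>M borel)" unfolding q_def by measurable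
  have PU: "P \<Otimes>\<^sub>M unit_interval = distr (L \<Otimes>\<^sub>M unit_interval) (borel \<Otimes>\<^sub>M unit_interval) (\<lambda>p. (weight_of (fst p), snd p))"
  proof -
    have "P \<Otimes>\<^sub>M distr unit_interval unit_interval (\<lambda>x. x)
        = distr (L \<Otimes>\<^sub>M unit_interval) (borel \<Otimes>\<^sub>M unit_interval) (\<lambda>(x, y). (weight_of x, y))"
      unfolding P_def
      by (rule pair_measure_distr) (simp_all add: distr_id U.sigma_finite_measure_axioms)
    then show ?thesis by (simp add: distr_id case_prod_beta')
  qed
  have law: "distr (L \<Otimes>\<^sub>M unit_interval) (borel \<Otimes>\<^sub>M borel) (\<lambda>p. (weight_of (fst p), q p))
      = distr L (borel \<Otimes>\<^sub>M borel) (\<lambda>b. (weight_of b, b))"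
    unfolding eq[symmetric] PU by (subst distr_distr) (auto simp: comp_def q_def)
  have 1: "distr (L \<Otimes>\<^sub>M unit_interval) borel q = L"
  proof -
    have "distr (L \<Otimes>\<^sub>M unit_interval) borel q
        = distr (distr (L \<Otimes>\<^sub>M unit_interval) (borel \<Otimes>\<^sub>M borel) (\<lambda>p. (weight_of (fst p), q p))) borel snd"
      by (subst distr_distr) (auto simp: comp_def)
    also have "\<dots> = distr L borel (\<lambda>b. b)"
      unfolding law by (subst distr_distr) (auto simp: comp_def)
    also have "\<dots> = L" by (rule distr_id2) (simp add: setsL)
    finally show ?thesis .
  qed
  have 2: "AE p in L \<Otimes>\<^sub>M unit_interval. weight_of (q p) = weight_of (fst p)"
  proof -
    have eq_sets: "{p \<in> space (borel \<Otimes>\<^sub>M borel). \<forall>x. weight_of (snd p) x = fst p x} \<in> sets (borel \<Otimes>\<^sub>M borel)"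
    proof -
      have "(\<lambda>p. weight_of (snd p) x) \<in> borel_measurable (borel \<Otimes>\<^sub>M borel)"
        "(\<lambda>p :: (site \<Rightarrow> real) \<times> (site \<Rightarrow> site \<Rightarrow> real). fst p x) \<in> borel_measurable (borel \<Otimes>\<^sub>M borel)" for x
        by (auto intro!: measurable_compose[OF measurable_fst measurable_product_coordinates]
            measurable_compose[OF measurable_snd measurable_product_then_coordinatewise[OF measurable_weight_of]])
      then show ?thesis by (intro sets.sets_Collect_countable_All borel_measurable_eq)
    qed
    have "AE p in distr L (borel \<Otimes>\<^sub>M borel) (\<lambda>b. (weight_of b, b)). \<forall>x. weight_of (snd p) x = fst p x"
      by (subst AE_distr_iff[OF _ eq_sets]) auto
    from this[folded law] have "AE p in L \<Otimes>\<^sub>M unit_interval. \<forall>x. weight_of (q p) x = weight_of (fst p) x"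
      by (subst (asm) AE_distr_iff[OF _ eq_sets]) auto
    then show ?thesis by (simp add: fun_eq_iff)
  qed
  define K where "K C r = emeasure unit_interval {u. Q (r, u) \<in> C}" for C r
  have K_meas[measurable]: "K C \<in> borel_measurable borel" if [measurable]: "C \<in> sets borel" for C
  proof -
    have "(\<lambda>r. emeasure unit_interval (Pair r -` {p \<in> space (borel \<Otimes>\<^sub>M unit_interval). Q p \<in> C})) \<in> borel_measurable borel"
      by (rule U.measurable_emeasure_Pair) measurable
    then show ?thesis unfolding K_def by (simp add: space_pair_measure spU vimage_def)
  qed
  have split: "emeasure (L \<Otimes>\<^sub>M unit_interval) {p. fst p \<in> D \<and> q p \<in> C} = (\<integral>\<^sup>+b. indicator D b * K C (weight_of b) \<partial>L)"
    if [measurable]: "D \<in> sets borel" "C \<in> sets borel" for D C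
  proof -
    have sp: "space (L \<Otimes>\<^sub>M unit_interval) = UNIV" by (simp add: space_pair_measure spL spU)
    have "{p \<in> space (L \<Otimes>\<^sub>M unit_interval). fst p \<in> D \<and> q p \<in> C} \<in> sets (L \<Otimes>\<^sub>M unit_interval)"
      by measurable
    then have "{p. fst p \<in> D \<and> q p \<in> C} \<in> sets (L \<Otimes>\<^sub>M unit_interval)" by (simp add: sp)
    from U.emeasure_pair_measure_alt[OF this]
    have "emeasure (L \<Otimes>\<^sub>M unit_interval) {p. fst p \<in> D \<and> q p \<in> C}
       = (\<integral>\<^sup>+b. emeasure unit_interval (Pair b -` {p. fst p \<in> D \<and> q p \<in> C}) \<partial>L)" .
    also have "\<dots> = (\<integral>\<^sup>+b. indicator D b * K C (weight_of b) \<partial>L)"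
      by (intro nn_integral_cong) (auto simp: K_def q_def vimage_def split: split_indicator)
    finally show ?thesis .
  qed
  have K: "(\<integral>\<^sup>+r. K C r * indicator E r \<partial>P) = emeasure L {b. weight_of b \<in> E \<and> b \<in> C}"
    if [measurable]: "E \<in> sets borel" "C \<in> sets borel" for E C
  proof -
    have "(\<integral>\<^sup>+r. K C r * indicator E r \<partial>P) = (\<integral>\<^sup>+b. indicator (weight_of -` E) b * K C (weight_of b) \<partial>L)"
      unfolding P_def by (subst nn_integral_distr) (auto intro!: nn_integral_cong split: split_indicator)
    also have "\<dots> = emeasure (L \<Otimes>\<^sub>M unit_interval) {p. fst p \<in> weight_of -` E \<and> q p \<in> C}"
      using measurable_sets[OF measurable_weight_of that(1)] by (intro split[symmetric]) simp_all
    also have "\<dots> = emeasure (distr (L \<Otimes>\<^sub>M unit_interval) (borel \<Otimes>\<^sub>M borel) (\<lambda>p. (weight_of (fst p), q p))) (E \<times> C)"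
      by (subst emeasure_distr) (auto intro!: arg_cong[where f="emeasure _"] simp: space_pair_measure spL spU)
    also have "\<dots> = emeasure L {b. weight_of b \<in> E \<and> b \<in> C}"
      unfolding law by (subst emeasure_distr) (auto intro!: arg_cong[where f="emeasure _"] simp: spL)
    finally show ?thesis .
  qed
  have invL: "emeasure L {b. translate z b \<in> X} = emeasure L X" if [measurable]: "X \<in> sets borel" for X z
  proof -
    have "emeasure L X = emeasure (distr L borel (translate z)) X" by (simp only: inv)
    also have "\<dots> = emeasure L {b. translate z b \<in> X}"
      by (subst emeasure_distr) (auto simp: spL vimage_def)
    finally show ?thesis ..
  qed
  have invP: "distr P borel (canonical_shift z) = P" for z
  proof -
    have "distr P borel (canonical_shift z) = distr (distr L borel (translate z)) borel weight_of"
      unfolding P_def by (simp add: distr_distr comp_def weight_of_translate)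
    also have "\<dots> = P" unfolding inv P_def ..
    finally show ?thesis .
  qed
  \<comment> \<open>The conditional law given shifted weights is the shifted conditional law, by uniqueness of
    densities.\<close>
  have K_shift: "AE r in P. K C (canonical_shift z r) = K (translate z -` C) r" if [measurable]: "C \<in> sets borel" for C z
  proof -
    have tC[measurable]: "translate z -` C \<in> sets borel"
      using measurable_sets[OF measurable_translate that, of z] by simp
    show ?thesis
    proof (rule P.density_unique_finite_measure)
      fix E assume "E \<in> sets P"
      then have E[measurable]: "E \<in> sets borel" by (simp add: P_def)
      define E' where "E' = canonical_shift (- z) -` E"
      have E'[measurable]: "E' \<in> sets borel"
        using measurable_sets[OF measurable_canonical_shift E, of "- z"] by (simp add: E'_def)
      have EE': "r \<in> E \<longleftrightarrow> canonical_shift z r \<in> E'" for r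
        by (simp add: E'_def canonical_shift_shift canonical_shift_0)
      have "(\<integral>\<^sup>+r. K C (canonical_shift z r) * indicator E r \<partial>P)
          = (\<integral>\<^sup>+r. K C (canonical_shift z r) * indicator E' (canonical_shift z r) \<partial>P)"
        by (intro nn_integral_cong) (simp add: indicator_def EE')
      also have "\<dots> = (\<integral>\<^sup>+r. K C r * indicator E' r \<partial>distr P borel (canonical_shift z))"
        by (subst nn_integral_distr) auto
      also have "\<dots> = emeasure L {b. weight_of b \<in> E' \<and> b \<in> C}" unfolding invP by (rule K) measurable
      also have "\<dots> = emeasure L {b. translate z b \<in> {b. weight_of b \<in> E' \<and> b \<in> C}}"
        by (rule invL[symmetric]) measurable
      also have "{b. translate z b \<in> {b. weight_of b \<in> E' \<and> b \<in> C}} = {b. weight_of b \<in> E \<and> b \<in> translate z -` C}"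
        by (auto simp: EE' weight_of_translate)
      also have "emeasure L \<dots> = (\<integral>\<^sup>+r. K (translate z -` C) r * indicator E r \<partial>P)"
        by (rule K[symmetric]) measurable
      finally show "(\<integral>\<^sup>+r. K C (canonical_shift z r) * indicator E r \<partial>P) = (\<integral>\<^sup>+r. K (translate z -` C) r * indicator E r \<partial>P)" .
    qed (use tC in measurable)
  qed
  have 3: "distr (L \<Otimes>\<^sub>M unit_interval) (borel \<Otimes>\<^sub>M borel) (\<lambda>p. (translate z (fst p), translate z (q p)))
      = distr (L \<Otimes>\<^sub>M unit_interval) (borel \<Otimes>\<^sub>M borel) (\<lambda>p. (fst p, q p))" for z
  proof (rule finite_measure_pair_eqI)
    show "finite_measure (distr (L \<Otimes>\<^sub>M unit_interval) (borel \<Otimes>\<^sub>M borel) (\<lambda>p. (translate z (fst p), translate z (q p))))"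
      by (rule LU.finite_measure_distr) measurable
    fix D C :: "(site \<Rightarrow> site \<Rightarrow> real) set" assume [measurable]: "D \<in> sets borel" "C \<in> sets borel"
    have tC[measurable]: "translate z -` C \<in> sets borel" and tD[measurable]: "translate z -` D \<in> sets borel"
      using measurable_sets[OF measurable_translate \<open>C \<in> sets borel\<close>, of z]
        measurable_sets[OF measurable_translate \<open>D \<in> sets borel\<close>, of z] by simp_all
    have "emeasure (distr (L \<Otimes>\<^sub>M unit_interval) (borel \<Otimes>\<^sub>M borel) (\<lambda>p. (translate z (fst p), translate z (q p)))) (D \<times> C)
        = emeasure (L \<Otimes>\<^sub>M unit_interval) {p. fst p \<in> translate z -` D \<and> q p \<in> translate z -` C}"
      by (subst emeasure_distr) (auto intro!: arg_cong[where f="emeasure _"] simp: space_pair_measure spL spU)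
    also have "\<dots> = (\<integral>\<^sup>+b. indicator (translate z -` D) b * K (translate z -` C) (weight_of b) \<partial>L)"
      by (rule split) measurable
    also have "\<dots> = (\<integral>\<^sup>+b. indicator D (translate z b) * K C (weight_of (translate z b)) \<partial>L)"
    proof (rule nn_integral_cong_AE)
      have "AE b in L. K C (canonical_shift z (weight_of b)) = K (translate z -` C) (weight_of b)"
        using K_shift[OF \<open>C \<in> sets borel\<close>, of z] unfolding P_def by (rule AE_distrD[rotated]) measurable
      then show "AE b in L. indicator (translate z -` D) b * K (translate z -` C) (weight_of b)
          = indicator D (translate z b) * K C (weight_of (translate z b))"
        by eventually_elim (simp add: weight_of_translate indicator_def)
    qed
    also have "\<dots> = (\<integral>\<^sup>+b. indicator D b * K C (weight_of b) \<partial>distr L borel (translate z))"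
      by (subst nn_integral_distr) auto
    also have "\<dots> = emeasure (L \<Otimes>\<^sub>M unit_interval) {p. fst p \<in> D \<and> q p \<in> C}"
      unfolding inv by (rule split[symmetric]) measurable
    also have "\<dots> = emeasure (distr (L \<Otimes>\<^sub>M unit_interval) (borel \<Otimes>\<^sub>M borel) (\<lambda>p. (fst p, q p))) (D \<times> C)"
      by (subst emeasure_distr) (auto intro!: arg_cong[where f="emeasure _"] simp: space_pair_measure spL spU)
    finally show "emeasure (distr (L \<Otimes>\<^sub>M unit_interval) (borel \<Otimes>\<^sub>M borel) (\<lambda>p. (translate z (fst p), translate z (q p)))) (D \<times> C)
        = emeasure (distr (L \<Otimes>\<^sub>M unit_interval) (borel \<Otimes>\<^sub>M borel) (\<lambda>p. (fst p, q p))) (D \<times> C)" .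
  qed simp_all
  show ?thesis
    using that[of Q] Q 1 2 3 unfolding q_def by blast
qed

section \<open>Invariant couplings with ordered increments\<close>

context extended_space
begin

lemma space_M: "space M = UNIV"
  using sets_M[THEN sets_eq_imp_space_eq] by simp

lemma measurable_T[measurable]: "T z \<in> measurable M M"
  using borel_measurable_continuous_onI[OF T_continuous] measurable_cong_sets[OF sets_M sets_M] by simp

lemma T_T: "T x (T y w) = T (x + y) w"
  using T_add[of x y] by (simp add: fun_eq_iff)

lemma AE_T: "AE w in M. P w \<Longrightarrow> AE w in M. P (T z w)"
  by (rule AE_distrD[OF measurable_T]) (simp only: T_invariant)

lemma AE_W_shift: "AE w in M. \<forall>x. W x (T z w) = W (x + z) w"
  using W_shift by (simp add: AE_all_countable)

lemma subalgebra_invariant: "subalgebra M (invariant_algebra M T)"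
proof -
  have "sigma_sets (space M) {A \<in> sets M. \<forall>z. T z -` A \<inter> space M = A} \<subseteq> sets M"
    by (rule sets.sigma_sets_subset) auto
  moreover have "{A \<in> sets M. \<forall>z. T z -` A \<inter> space M = A} \<subseteq> Pow (space M)"
    using sets.sets_into_space by auto
  ultimately show ?thesis
    by (simp add: subalgebra_def invariant_algebra_def space_measure_of_conv)
qed

text \<open>
  The function \<open>f\<close> is only almost invariant; its supremum over the group is a bounded version that is exactly
  invariant, hence measurable with respect to the invariant \<open>\<sigma>\<close>-algebra.
\<close>

lemma integral_invariant_mult:
  fixes f g :: "'a \<Rightarrow> real"
  assumes g: "integrable M g" and c: "AE w in M. real_cond_exp M (invariant_algebra M T) g w = c"
    and f[measurable]: "f \<in> borel_measurable M" and bounds: "\<And>w. 0 \<le> f w" "\<And>w. f w \<le> 1"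
    and inv: "\<And>z. AE w in M. f (T z w) = f w"
  shows "(\<integral>w. f w * g w \<partial>M) = c * (\<integral>w. f w \<partial>M)"
proof -
  interpret sub: finite_measure_subalgebra M "invariant_algebra M T"
    by unfold_locales (rule subalgebra_invariant)
  have g_meas[measurable]: "g \<in> borel_measurable M" using g by simp
  define F where "F w = (SUP z. f (T z w))" for w
  have bdd: "bdd_above (range (\<lambda>z. f (T z w)))" for w
    by (rule bdd_aboveI[of _ 1]) (auto simp: bounds)
  have F_meas[measurable]: "F \<in> borel_measurable M"
    unfolding F_def by (rule borel_measurable_cSUP) (use bdd in auto)
  have F_bounds: "0 \<le> F w" "F w \<le> 1" for w
    unfolding F_def using bounds by (auto intro!: cSUP_upper2[OF bdd] cSUP_least)
  have F_inv: "F (T z w) = F w" for z w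
  proof -
    have "range (\<lambda>x. x + z) = UNIV" by (metis surj_def diff_add_cancel)
    then have "range (\<lambda>x. f (T x w)) = (\<lambda>x. f (T x w)) ` range (\<lambda>x. x + z)" by (simp only:)
    also have "\<dots> = range (\<lambda>x. f (T x (T z w)))" unfolding T_T by (rule image_image)
    finally have "range (\<lambda>x. f (T x (T z w))) = range (\<lambda>x. f (T x w))" ..
    then show ?thesis by (simp add: F_def)
  qed
  have F_eq: "AE w in M. F w = f w"
  proof -
    have "AE w in M. \<forall>z. f (T z w) = f w" using inv by (simp add: AE_all_countable)
    then show ?thesis
    proof eventually_elim
      case (elim w)
      then have "(\<lambda>z. f (T z w)) = (\<lambda>_. f w)" by blast
      then show ?case unfolding F_def by (simp only: cSUP_const[OF UNIV_not_empty])
    qed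
  qed
  have "F \<in> borel_measurable (invariant_algebra M T)"
  proof (rule borel_measurableI_le)
    fix a
    have "{w \<in> space M. F w \<le> a} \<in> {A \<in> sets M. \<forall>z. T z -` A \<inter> space M = A}"
    proof -
      have "{w \<in> space M. F w \<le> a} \<in> sets M" by measurable
      then show ?thesis by (auto simp: F_inv space_M)
    qed
    moreover have "space (invariant_algebra M T) = space M"
      using subalgebra_invariant by (simp add: subalgebra_def)
    moreover have "{A \<in> sets M. \<forall>z. T z -` A \<inter> space M = A} \<subseteq> Pow (space M)"
      using sets.sets_into_space by auto
    ultimately show "{w \<in> space (invariant_algebra M T). F w \<le> a} \<in> sets (invariant_algebra M T)"
      unfolding invariant_algebra_def by (auto intro!: sigma_sets.Basic)
  qed
  moreover have "integrable M (\<lambda>w. F w * g w)"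
    by (rule Bochner_Integration.integrable_bound[OF g])
       (use F_bounds in \<open>auto intro!: AE_I2 mult_left_le_one_le simp: abs_mult\<close>)
  ultimately have "(\<integral>w. F w * g w \<partial>M) = (\<integral>w. F w * real_cond_exp M (invariant_algebra M T) g w \<partial>M)"
    by (intro sub.real_cond_exp_intg(2)[symmetric]) auto
  also have "\<dots> = (\<integral>w. F w * c \<partial>M)"
    by (rule integral_cong_AE) (use c in \<open>auto elim!: eventually_mono\<close>)
  finally have "(\<integral>w. F w * g w \<partial>M) = c * (\<integral>w. F w \<partial>M)" by (simp add: mult.commute)
  moreover have "(\<integral>w. F w * g w \<partial>M) = (\<integral>w. f w * g w \<partial>M)" "(\<integral>w. F w \<partial>M) = (\<integral>w. f w \<partial>M)"
    by (rule integral_cong_AE; use F_eq in \<open>auto elim!: eventually_mono\<close>)+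
  ultimately show ?thesis by simp
qed

end

text \<open>
  The mean increment under an invariant measure \<open>\<mu> \<le> L\<close> is the deterministic constant \<open>c\<close> times
  the mass of \<open>\<mu>\<close>, since the density of \<open>\<mu>\<close> is almost invariant.
\<close>

lemma integral_edge_eq_mean:
  fixes L :: "(site \<Rightarrow> site \<Rightarrow> real) measure"
  assumes L: "prob_space L" and setsL[measurable_cong]: "sets L = sets borel"
    and invL: "\<And>z. distr L borel (translate z) = L"
    and mean: "\<And>f. f \<in> borel_measurable borel \<Longrightarrow> (\<And>b. 0 \<le> f b \<and> f b \<le> 1) \<Longrightarrow> (\<And>z. AE b in L. f (translate z b) = f b)
        \<Longrightarrow> (\<integral>b. f b * b 0 e \<partial>L) = c * (\<integral>b. f b \<partial>L)"
    and sets\<mu>[measurable_cong]: "sets \<mu> = sets borel"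
    and inv\<mu>: "\<And>z. distr \<mu> borel (translate z) = \<mu>"
    and le: "\<And>D. D \<in> sets borel \<Longrightarrow> emeasure \<mu> D \<le> emeasure L D"
  shows "(\<integral>b. b 0 e \<partial>\<mu>) = c * measure \<mu> UNIV"
proof -
  interpret L: prob_space L by fact
  have spL: "space L = UNIV" "space \<mu> = UNIV"
    using setsL[THEN sets_eq_imp_space_eq] sets\<mu>[THEN sets_eq_imp_space_eq] by simp_all
  define \<phi> where "\<phi> = RN_deriv L \<mu>"
  have [measurable]: "\<phi> \<in> borel_measurable borel"
    using borel_measurable_RN_deriv[of L \<mu>] unfolding \<phi>_def by measurable
  have dens: "density L \<phi> = \<mu>"
    unfolding \<phi>_def
  proof (rule L.density_RN_deriv)
    show "absolutely_continuous L \<mu>"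
      unfolding absolutely_continuous_def
    proof
      fix E assume "E \<in> null_sets L"
      then show "E \<in> null_sets \<mu>" using le[of E] by (auto simp: null_sets_def sets\<mu> setsL)
    qed
  qed (simp add: sets\<mu> setsL)
  have \<phi>_le: "AE b in L. \<phi> b \<le> 1"
  proof (rule AE_le_of_nn_integral_le)
    fix E assume E: "E \<in> sets L"
    then have "(\<integral>\<^sup>+b. \<phi> b * indicator E b \<partial>L) = emeasure \<mu> E"
      unfolding dens[symmetric] by (subst emeasure_density) auto
    also have "\<dots> \<le> (\<integral>\<^sup>+b. 1 * indicator E b \<partial>L)" using le[of E] E by (simp add: setsL)
    finally show "(\<integral>\<^sup>+b. \<phi> b * indicator E b \<partial>L) \<le> (\<integral>\<^sup>+b. 1 * indicator E b \<partial>L)" .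
  qed (auto simp: L.emeasure_space_1)
  have \<phi>_inv: "AE b in L. \<phi> (translate z b) = \<phi> b" for z
  proof (rule L.density_unique_finite_measure)
    fix E assume "E \<in> sets L"
    then have E[measurable]: "E \<in> sets borel" by (simp add: setsL)
    define E' where "E' = translate (- z) -` E"
    have E'[measurable]: "E' \<in> sets borel"
      using measurable_sets[OF measurable_translate E, of "- z"] by (simp add: E'_def)
    have EE': "b \<in> E \<longleftrightarrow> translate z b \<in> E'" for b
      by (simp add: E'_def translate_translate translate_0)
    have "(\<integral>\<^sup>+b. \<phi> (translate z b) * indicator E b \<partial>L) = (\<integral>\<^sup>+b. \<phi> (translate z b) * indicator E' (translate z b) \<partial>L)"
      by (intro nn_integral_cong) (simp add: indicator_def EE')
    also have "\<dots> = (\<integral>\<^sup>+b. \<phi> b * indicator E' b \<partial>distr L borel (translate z))"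
      by (subst nn_integral_distr) auto
    also have "\<dots> = emeasure \<mu> E'"
      unfolding invL dens[symmetric] by (subst emeasure_density) auto
    also have "\<dots> = emeasure (distr \<mu> borel (translate z)) E'" by (simp only: inv\<mu>)
    also have "\<dots> = emeasure \<mu> E"
      by (subst emeasure_distr) (auto intro!: arg_cong[where f="emeasure _"] simp: spL EE')
    also have "\<dots> = (\<integral>\<^sup>+b. \<phi> b * indicator E b \<partial>L)"
      unfolding dens[symmetric] by (subst emeasure_density) auto
    finally show "(\<integral>\<^sup>+b. \<phi> (translate z b) * indicator E b \<partial>L) = (\<integral>\<^sup>+b. \<phi> b * indicator E b \<partial>L)" .
  qed measurable
  \<comment> \<open>The truncation changes the density only on a null set, because \<open>\<mu> \<le> L\<close>.\<close>
  define f where "f b = min 1 (enn2real (\<phi> b))" for b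
  have [measurable]: "f \<in> borel_measurable borel" unfolding f_def by measurable
  have f_bounds: "0 \<le> f b \<and> f b \<le> 1" for b by (simp add: f_def)
  have f_inv: "AE b in L. f (translate z b) = f b" for z
    using \<phi>_inv[of z] by eventually_elim (simp add: f_def)
  have \<mu>: "\<mu> = density L (\<lambda>b. ennreal (f b))"
    unfolding dens[symmetric]
  proof (rule density_cong)
    show "AE b in L. \<phi> b = ennreal (f b)"
      using \<phi>_le
    proof eventually_elim
      case (elim b)
      then show ?case by (cases "\<phi> b") (auto simp: f_def top_unique)
    qed
  qed measurable
  have "(\<integral>b. b 0 e \<partial>\<mu>) = (\<integral>b. f b * b 0 e \<partial>L)"
    unfolding \<mu> using f_bounds by (subst integral_density) auto
  also have "\<dots> = c * (\<integral>b. f b \<partial>L)"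
    by (rule mean) (use f_bounds f_inv in auto)
  also have "(\<integral>b. f b \<partial>L) = (\<integral>b. 1 \<partial>\<mu>)"
    unfolding \<mu> using f_bounds by (subst integral_density) auto
  also have "\<dots> = measure \<mu> UNIV" by (simp add: spL)
  finally show ?thesis .
qed

text \<open>
  The key step of the first part. On the invariant event that one component dominates the other on all
  \<open>e\<close>-edges, the difference of the increments has a sign, and its mean vanishes because both copies have mean increment \<open>c\<close> there.
\<close>

lemma edges_eq_of_ordered_coupling:
  fixes L :: "(site \<Rightarrow> site \<Rightarrow> real) measure" and \<nu> :: "((site \<Rightarrow> site \<Rightarrow> real) \<times> (site \<Rightarrow> site \<Rightarrow> real)) measure"
  assumes L: "prob_space L" and setsL[measurable_cong]: "sets L = sets borel"
    and invL: "\<And>z. distr L borel (translate z) = L"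
    and int: "integrable L (\<lambda>b. b 0 e)"
    and mean: "\<And>f. f \<in> borel_measurable borel \<Longrightarrow> (\<And>b. 0 \<le> f b \<and> f b \<le> 1) \<Longrightarrow> (\<And>z. AE b in L. f (translate z b) = f b)
        \<Longrightarrow> (\<integral>b. f b * b 0 e \<partial>L) = c * (\<integral>b. f b \<partial>L)"
    and sets\<nu>[measurable_cong]: "sets \<nu> = sets (borel \<Otimes>\<^sub>M borel)"
    and inv\<nu>: "\<And>z. distr \<nu> (borel \<Otimes>\<^sub>M borel) (\<lambda>p. (translate z (fst p), translate z (snd p))) = \<nu>"
    and marg: "distr \<nu> borel fst = L" "distr \<nu> borel snd = L"
    and ord: "AE p in \<nu>. (\<forall>x. fst p x (x + e) \<le> snd p x (x + e)) \<or> (\<forall>x. snd p x (x + e) \<le> fst p x (x + e))"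
  shows "AE p in \<nu>. \<forall>x. fst p x (x + e) = snd p x (x + e)"
proof -
  interpret L: prob_space L by fact
  have sp: "space \<nu> = UNIV"
    using sets\<nu>[THEN sets_eq_imp_space_eq] by (simp add: space_pair_measure)
  have "prob_space \<nu>"
  proof
    have "emeasure \<nu> (space \<nu>) = emeasure (distr \<nu> borel fst) UNIV"
      by (subst emeasure_distr) (auto simp: sp)
    then show "emeasure \<nu> (space \<nu>) = 1"
      unfolding marg using L.emeasure_space_1 setsL[THEN sets_eq_imp_space_eq] by simp
  qed
  then interpret N: prob_space \<nu> .
  define tr where "tr z p = (translate z (fst p), translate z (snd p))"
    for z and p :: "(site \<Rightarrow> site \<Rightarrow> real) \<times> (site \<Rightarrow> site \<Rightarrow> real)"
  have tr_meas[measurable]: "tr z \<in> measurable (borel \<Otimes>\<^sub>M borel) (borel \<Otimes>\<^sub>M borel)" for z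
    unfolding tr_def by measurable
  have tr_inv: "distr \<nu> (borel \<Otimes>\<^sub>M borel) (tr z) = \<nu>" for z
    using inv\<nu>[of z] by (simp add: tr_def[abs_def])
  have edge_meas[measurable]:
    "(\<lambda>p :: (site \<Rightarrow> site \<Rightarrow> real) \<times> (site \<Rightarrow> site \<Rightarrow> real). fst p x y) \<in> borel_measurable (borel \<Otimes>\<^sub>M borel)"
    "(\<lambda>p :: (site \<Rightarrow> site \<Rightarrow> real) \<times> (site \<Rightarrow> site \<Rightarrow> real). snd p x y) \<in> borel_measurable (borel \<Otimes>\<^sub>M borel)"
    for x y
    by (rule measurable_compose[OF measurable_fst measurable_two_site_apply]
        measurable_compose[OF measurable_snd measurable_two_site_apply])+
  have mean_on: "(\<integral>p. indicator A p * \<pi> p 0 e \<partial>\<nu>) = c * measure \<nu> A"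
    if A[measurable]: "A \<in> sets (borel \<Otimes>\<^sub>M borel)" and A_inv: "\<And>z p. tr z p \<in> A \<longleftrightarrow> p \<in> A"
      and \<pi>[measurable]: "\<pi> \<in> borel_measurable (borel \<Otimes>\<^sub>M borel)" and \<pi>L: "distr \<nu> borel \<pi> = L"
      and \<pi>_tr: "\<And>z p. \<pi> (tr z p) = translate z (\<pi> p)"
    for A and \<pi> :: "(site \<Rightarrow> site \<Rightarrow> real) \<times> (site \<Rightarrow> site \<Rightarrow> real) \<Rightarrow> site \<Rightarrow> site \<Rightarrow> real"
  proof -
    define \<mu> where "\<mu> = distr (density \<nu> (indicator A)) borel \<pi>"
    have \<mu>: "emeasure \<mu> D = emeasure \<nu> {p. p \<in> A \<and> \<pi> p \<in> D}" if [measurable]: "D \<in> sets borel" for D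
    proof -
      have "emeasure \<mu> D = (\<integral>\<^sup>+p. indicator A p * indicator (\<pi> -` D \<inter> space \<nu>) p \<partial>\<nu>)"
        unfolding \<mu>_def by (subst emeasure_distr) (auto simp: emeasure_density)
      also have "\<dots> = (\<integral>\<^sup>+p. indicator {p \<in> space \<nu>. p \<in> A \<and> \<pi> p \<in> D} p \<partial>\<nu>)"
        by (intro nn_integral_cong) (auto split: split_indicator)
      also have "\<dots> = emeasure \<nu> {p \<in> space \<nu>. p \<in> A \<and> \<pi> p \<in> D}"
        by (rule nn_integral_indicator) measurable
      finally show ?thesis by (simp add: sp)
    qed
    have "(\<integral>b. b 0 e \<partial>\<mu>) = c * measure \<mu> UNIV"
    proof (rule integral_edge_eq_mean[OF L setsL invL mean])
      show "distr \<mu> borel (translate z) = \<mu>" for z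
      proof (rule measure_eqI)
        fix D assume "D \<in> sets (distr \<mu> borel (translate z))"
        then have D[measurable]: "D \<in> sets borel" by simp
        have tD[measurable]: "translate z -` D \<in> sets borel"
          using measurable_sets[OF measurable_translate D, of z] by simp
        have set: "{p. p \<in> A \<and> \<pi> p \<in> D} \<in> sets (borel \<Otimes>\<^sub>M borel)"
        proof -
          have "{p \<in> space (borel \<Otimes>\<^sub>M borel). p \<in> A \<and> \<pi> p \<in> D} \<in> sets (borel \<Otimes>\<^sub>M borel)" by measurable
          then show ?thesis by (simp add: space_pair_measure)
        qed
        have "emeasure (distr \<mu> borel (translate z)) D = emeasure \<mu> (translate z -` D)"
          by (subst emeasure_distr) (auto simp: \<mu>_def)
        also have "\<dots> = emeasure \<nu> {p. p \<in> A \<and> \<pi> p \<in> translate z -` D}" by (rule \<mu>) measurable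
        also have "\<dots> = emeasure \<nu> (tr z -` {p. p \<in> A \<and> \<pi> p \<in> D} \<inter> space \<nu>)"
          by (auto intro!: arg_cong[where f="emeasure _"] simp: sp A_inv \<pi>_tr)
        also have "\<dots> = emeasure (distr \<nu> (borel \<Otimes>\<^sub>M borel) (tr z)) {p. p \<in> A \<and> \<pi> p \<in> D}"
          using set by (subst emeasure_distr) auto
        also have "\<dots> = emeasure \<mu> D" unfolding tr_inv \<mu>[OF D] ..
        finally show "emeasure (distr \<mu> borel (translate z)) D = emeasure \<mu> D" .
      qed (simp add: \<mu>_def)
    next
      fix D :: "(site \<Rightarrow> site \<Rightarrow> real) set" assume D[measurable]: "D \<in> sets borel"
      have "emeasure \<mu> D \<le> emeasure \<nu> (\<pi> -` D \<inter> space \<nu>)"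
        unfolding \<mu>[OF D]
      proof (rule emeasure_mono)
        show "\<pi> -` D \<inter> space \<nu> \<in> sets \<nu>" by (rule measurable_sets[of _ _ borel]) measurable
      qed (auto simp: sp)
      also have "\<dots> = emeasure (distr \<nu> borel \<pi>) D" by (rule emeasure_distr[symmetric]) measurable
      finally show "emeasure \<mu> D \<le> emeasure L D" unfolding \<pi>L .
    qed (simp_all add: \<mu>_def)
    moreover have "measure \<mu> UNIV = measure \<nu> A"
      unfolding measure_def by (subst \<mu>) (auto)
    moreover have "(\<integral>b. b 0 e \<partial>\<mu>) = (\<integral>p. indicator A p * \<pi> p 0 e \<partial>\<nu>)"
    proof -
      have [measurable]: "(\<lambda>p. \<pi> p 0 e) \<in> borel_measurable (borel \<Otimes>\<^sub>M borel)"
        by (rule measurable_compose[OF \<pi> measurable_two_site_apply])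
      have "(\<integral>b. b 0 e \<partial>\<mu>) = (\<integral>p. \<pi> p 0 e \<partial>density \<nu> (\<lambda>p. ennreal (indicator A p)))"
        unfolding \<mu>_def by (subst integral_distr) (auto simp: ennreal_indicator)
      also have "\<dots> = (\<integral>p. indicator A p * \<pi> p 0 e \<partial>\<nu>)"
        by (subst integral_density) auto
      finally show ?thesis .
    qed
    ultimately show ?thesis by simp
  qed
  have intN: "integrable \<nu> (\<lambda>p. fst p 0 e)" "integrable \<nu> (\<lambda>p. snd p 0 e)"
  proof -
    have "integrable (distr \<nu> borel fst) (\<lambda>b. b 0 e)" "integrable (distr \<nu> borel snd) (\<lambda>b. b 0 e)"
      unfolding marg by (rule int)+
    then show "integrable \<nu> (\<lambda>p. fst p 0 e)" "integrable \<nu> (\<lambda>p. snd p 0 e)"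
      by (simp_all add: integrable_distr_eq)
  qed
  have zero: "(\<integral>p. indicator A p * (snd p 0 e - fst p 0 e) \<partial>\<nu>) = 0"
    if A[measurable]: "A \<in> sets (borel \<Otimes>\<^sub>M borel)" and A_inv: "\<And>z p. tr z p \<in> A \<longleftrightarrow> p \<in> A" for A
  proof -
    have "integrable \<nu> (\<lambda>p. indicator A p * fst p 0 e)" "integrable \<nu> (\<lambda>p. indicator A p * snd p 0 e)"
      using intN[THEN integrable_mult_indicator[rotated], of A] by simp_all
    then have "(\<integral>p. indicator A p * (snd p 0 e - fst p 0 e) \<partial>\<nu>)
        = (\<integral>p. indicator A p * snd p 0 e \<partial>\<nu>) - (\<integral>p. indicator A p * fst p 0 e \<partial>\<nu>)"
      by (simp add: right_diff_distrib)
    then show ?thesis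
      using mean_on[OF A A_inv, of fst] mean_on[OF A A_inv, of snd] marg by (simp add: tr_def)
  qed
  have AE_tr: "AE p in \<nu>. Pr (tr z p)" if "AE p in \<nu>. Pr p" for Pr z
  proof (rule AE_distrD[where M'="borel \<Otimes>\<^sub>M borel" and f="tr z"])
    show "AE p in distr \<nu> (borel \<Otimes>\<^sub>M borel) (tr z). Pr p" unfolding tr_inv by (rule that)
  qed measurable
  define A where "A = {p :: (site \<Rightarrow> site \<Rightarrow> real) \<times> (site \<Rightarrow> site \<Rightarrow> real). \<forall>x. fst p x (x + e) \<le> snd p x (x + e)}"
  define A' where "A' = {p :: (site \<Rightarrow> site \<Rightarrow> real) \<times> (site \<Rightarrow> site \<Rightarrow> real). \<forall>x. snd p x (x + e) \<le> fst p x (x + e)}"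
  have A_meas[measurable]: "A \<in> sets (borel \<Otimes>\<^sub>M borel)" "A' \<in> sets (borel \<Otimes>\<^sub>M borel)"
  proof -
    have "{p \<in> space (borel \<Otimes>\<^sub>M borel :: ((site \<Rightarrow> site \<Rightarrow> real) \<times> (site \<Rightarrow> site \<Rightarrow> real)) measure). \<forall>x. fst p x (x + e) \<le> snd p x (x + e)} \<in> sets (borel \<Otimes>\<^sub>M borel)"
      "{p \<in> space (borel \<Otimes>\<^sub>M borel :: ((site \<Rightarrow> site \<Rightarrow> real) \<times> (site \<Rightarrow> site \<Rightarrow> real)) measure). \<forall>x. snd p x (x + e) \<le> fst p x (x + e)} \<in> sets (borel \<Otimes>\<^sub>M borel)"
      by (intro sets.sets_Collect_countable_All borel_measurable_le edge_meas)+
    then show "A \<in> sets (borel \<Otimes>\<^sub>M borel)" "A' \<in> sets (borel \<Otimes>\<^sub>M borel)" by (simp_all add: A_def A'_def space_pair_measure)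
  qed
  have translate_edge: "translate z b x (x + e) = b (x + z) (x + z + e)" for z b x
    by (simp add: translate_def algebra_simps)
  have all_shift: "(\<forall>x :: site. Pr (x + z)) \<longleftrightarrow> (\<forall>x. Pr x)" for Pr z
    by (metis diff_add_cancel)
  have A_inv: "tr z p \<in> A \<longleftrightarrow> p \<in> A" "tr z p \<in> A' \<longleftrightarrow> p \<in> A'" for z p
    using all_shift[of "\<lambda>x. fst p x (x + e) \<le> snd p x (x + e)" z] all_shift[of "\<lambda>x. snd p x (x + e) \<le> fst p x (x + e)" z]
    by (simp_all only: A_def A'_def tr_def mem_Collect_eq fst_conv snd_conv translate_edge)
  have intD: "integrable \<nu> (\<lambda>p. indicator C p * (snd p 0 e - fst p 0 e))" if "C \<in> sets (borel \<Otimes>\<^sub>M borel)" for C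
    using integrable_mult_indicator[OF _ Bochner_Integration.integrable_diff[OF intN(2,1)], of C] that by (simp add: sets\<nu>)
  have edge0: "p \<in> A \<Longrightarrow> fst p 0 e \<le> snd p 0 e" "p \<in> A' \<Longrightarrow> snd p 0 e \<le> fst p 0 e" for p
    using spec[of "\<lambda>x. fst p x (x + e) \<le> snd p x (x + e)" 0] spec[of "\<lambda>x. snd p x (x + e) \<le> fst p x (x + e)" 0]
    by (simp_all add: A_def A'_def)
  have "AE p in \<nu>. indicator A p * (snd p 0 e - fst p 0 e) = 0"
    using zero[OF A_meas(1) A_inv(1)] intD[OF A_meas(1)]
    by (subst (asm) integral_nonneg_eq_0_iff_AE) (auto split: split_indicator simp: edge0)
  moreover have "(\<integral>p. indicator A' p * (fst p 0 e - snd p 0 e) \<partial>\<nu>) = 0"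
  proof -
    have "(\<integral>p. indicator A' p * (fst p 0 e - snd p 0 e) \<partial>\<nu>) = (\<integral>p. - (indicator A' p * (snd p 0 e - fst p 0 e)) \<partial>\<nu>)"
      by (rule Bochner_Integration.integral_cong) (auto simp: algebra_simps)
    then show ?thesis using zero[OF A_meas(2) A_inv(2)] by simp
  qed
  moreover have "integrable \<nu> (\<lambda>p. indicator A' p * (fst p 0 e - snd p 0 e))"
    using integrable_mult_indicator[OF _ Bochner_Integration.integrable_diff[OF intN(1,2)], of A'] A_meas(2) by (simp add: sets\<nu>)
  ultimately have "AE p in \<nu>. indicator A p * (snd p 0 e - fst p 0 e) = 0" "AE p in \<nu>. indicator A' p * (fst p 0 e - snd p 0 e) = 0"
    by (auto simp: integral_nonneg_eq_0_iff_AE edge0 split: split_indicator)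
  with ord have "AE p in \<nu>. fst p 0 e = snd p 0 e"
    by eventually_elim (auto simp: A_def A'_def)
  then have "AE p in \<nu>. \<forall>z. fst (tr z p) 0 e = snd (tr z p) 0 e"
    unfolding AE_all_countable by (intro allI AE_tr)
  then show ?thesis
    by eventually_elim (simp add: tr_def translate_def add.commute)
qed

section \<open>The cocycle is a function of the weights\<close>

lemma AE_pair_fix_snd:
  assumes "prob_space M1" "prob_space M2" and ae: "AE p in M1 \<Otimes>\<^sub>M M2. R (fst p) (snd p)"
  obtains y where "y \<in> space M2" "AE x in M1. R x y"
proof -
  interpret M1: prob_space M1 by fact
  interpret M2: prob_space M2 by fact
  interpret P: pair_prob_space M1 M2 ..
  interpret Q: pair_prob_space M2 M1 ..
  have "AE p in M2 \<Otimes>\<^sub>M M1. R (fst (case p of (x, y) \<Rightarrow> (y, x))) (snd (case p of (x, y) \<Rightarrow> (y, x)))"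
  proof (rule AE_distrD[where P="\<lambda>p. R (fst p) (snd p)" and M'="M1 \<Otimes>\<^sub>M M2" and f="\<lambda>(x, y). (y, x)"])
    show "AE p in distr (M2 \<Otimes>\<^sub>M M1) (M1 \<Otimes>\<^sub>M M2) (\<lambda>(x, y). (y, x)). R (fst p) (snd p)"
      unfolding P.distr_pair_swap[symmetric] by (rule ae)
  qed measurable
  from Q.AE_pair[OF this] have "AE y in M2. AE x in M1. R x y" by simp
  with AE_space have "AE y in M2. y \<in> space M2 \<and> (AE x in M1. R x y)" by eventually_elim auto
  then have "\<exists>y. y \<in> space M2 \<and> (AE x in M1. R x y)"
    using eventually_happens[of _ "ae_filter M2"] M2.emeasure_space_1 by (auto simp: ae_filter_eq_bot_iff)
  with that show ?thesis by blast
qed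

lemma AE_fst_pair:
  assumes "prob_space M1" "prob_space M2" "AE x in M1. R x"
  shows "AE p in M1 \<Otimes>\<^sub>M M2. R (fst p)"
proof (rule AE_distrD[where P=R and M'=M1 and f=fst])
  show "AE x in distr (M1 \<Otimes>\<^sub>M M2) M1 fst. R x"
    unfolding prob_space.distr_pair_fst[OF assms(2)] by (rule assms(3))
qed measurable

lemma (in extended_space) cocycle_function_of_weights:
  assumes Bh: "Bh \<in> coalescing_cocycles M T W"
    and mean: "AE w in M. mean_vec M T Bh w = h"
  obtains F where "F \<in> borel_measurable borel" "AE w in M. Bh w = F (\<lambda>x. W x w)"
proof -
  have joint: "(\<lambda>(w, x, y). Bh w x y) \<in> borel_measurable (M \<Otimes>\<^sub>M count_space UNIV \<Otimes>\<^sub>M count_space UNIV)"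
    and coc: "AE w in M. cocycle (Bh w) \<and> recovers (Bh w) (\<lambda>x. W x w)"
    and shift: "AE w in M. \<forall>x y z. Bh w (x + z) (y + z) = Bh (T z w) x y"
    and intB: "\<And>x y. integrable M (\<lambda>w. Bh w x y)"
    and coal: "AE w in M. \<forall>u v. coalesce (geodesic (Bh w) u) (geodesic (Bh w) v)"
    using Bh by (auto simp: coalescing_cocycles_def cocycles_def)
  have Bh_meas[measurable]: "Bh \<in> borel_measurable M"
    by (rule measurable_two_site_function) (use intB in auto)
  define L where "L = distr M borel Bh"
  have setsL[measurable_cong]: "sets L = sets borel" by (simp add: L_def)
  have L: "prob_space L" unfolding L_def by (rule prob_space_distr) measurable
  interpret L: prob_space L by fact
  interpret U: prob_space unit_interval by (rule prob_space_unit_interval)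
  have shift': "AE w in M. Bh (T z w) = translate z (Bh w)" for z
    using shift
  proof eventually_elim
    case (elim w)
    then show ?case unfolding translate_def by (intro ext) metis
  qed
  have invL: "distr L borel (translate z) = L" for z
  proof -
    have "distr L borel (translate z) = distr M borel (\<lambda>w. translate z (Bh w))"
      unfolding L_def by (subst distr_distr) (auto simp: comp_def)
    also have "\<dots> = distr M borel (\<lambda>w. Bh (T z w))"
      by (rule distr_cong_AE) (use shift'[of z] in \<open>auto elim!: eventually_mono\<close>)
    also have "\<dots> = distr (distr M M (T z)) borel Bh"
      by (subst distr_distr) (auto simp: comp_def)
    finally show ?thesis unfolding T_invariant L_def .
  qed
  have good: "AE b in L. coalescing b"
    unfolding L_def
  proof (subst AE_distr_iff)
    show "AE w in M. coalescing (Bh w)" using coc coal by eventually_elim (simp add: coalescing_def)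
  qed measurable
  have weight: "AE w in M. weight_of (Bh w) = (\<lambda>x. W x w)"
    using coc by eventually_elim (simp add: recovers_def weight_of_def fun_eq_iff)
  have intL: "integrable L (\<lambda>b. b 0 e)" for e
    unfolding L_def using intB by (subst integrable_distr_eq) auto
  have meanL: "(\<integral>b. f b * b 0 e \<partial>L) = c * (\<integral>b. f b \<partial>L)"
    if [measurable]: "f \<in> borel_measurable borel" and f: "\<And>b. 0 \<le> f b \<and> f b \<le> 1" and inv: "\<And>z. AE b in L. f (translate z b) = f b"
      and c: "AE w in M. real_cond_exp M (invariant_algebra M T) (\<lambda>w. Bh w 0 e) w = c" for f c e
  proof -
    have "AE w in M. f (Bh (T z w)) = f (Bh w)" for z
      using shift'[of z] AE_distrD[OF Bh_meas inv[of z, unfolded L_def]] by eventually_elim simp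
    then have "(\<integral>w. f (Bh w) * Bh w 0 e \<partial>M) = c * (\<integral>w. f (Bh w) \<partial>M)"
      by (intro integral_invariant_mult intB c) (use f in auto)
    then show ?thesis unfolding L_def by (simp add: integral_distr)
  qed
  from conditional_coupling[OF L setsL invL]
  obtain Q where Q[measurable]: "Q \<in> borel_measurable (borel \<Otimes>\<^sub>M borel)"
    and margQ: "distr (L \<Otimes>\<^sub>M unit_interval) borel (\<lambda>p. Q (weight_of (fst p), snd p)) = L"
    and weightQ: "AE p in L \<Otimes>\<^sub>M unit_interval. weight_of (Q (weight_of (fst p), snd p)) = weight_of (fst p)"
    and invQ: "\<And>z. distr (L \<Otimes>\<^sub>M unit_interval) (borel \<Otimes>\<^sub>M borel)
                (\<lambda>p. (translate z (fst p), translate z (Q (weight_of (fst p), snd p))))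
            = distr (L \<Otimes>\<^sub>M unit_interval) (borel \<Otimes>\<^sub>M borel) (\<lambda>p. (fst p, Q (weight_of (fst p), snd p)))"
    by blast
  define q where "q p = Q (weight_of (fst p), snd p)" for p
  have q_meas[measurable]: "q \<in> borel_measurable (borel \<Otimes>\<^sub>M borel)" unfolding q_def by measurable
  define \<nu> where "\<nu> = distr (L \<Otimes>\<^sub>M unit_interval) (borel \<Otimes>\<^sub>M borel) (\<lambda>p. (fst p, q p))"
  have good2: "AE p in L \<Otimes>\<^sub>M unit_interval. coalescing (fst p)" "AE p in L \<Otimes>\<^sub>M unit_interval. coalescing (q p)"
  proof -
    show "AE p in L \<Otimes>\<^sub>M unit_interval. coalescing (fst p)"
      by (rule AE_fst_pair[OF L prob_space_unit_interval good])
    show "AE p in L \<Otimes>\<^sub>M unit_interval. coalescing (q p)"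
    proof (rule AE_distrD[where P=coalescing and M'=borel and f=q])
      show "AE b in distr (L \<Otimes>\<^sub>M unit_interval) borel q. coalescing b"
        using good unfolding margQ[folded q_def] .
    qed measurable
  qed
  have edge_meas:
    "(\<lambda>p :: (site \<Rightarrow> site \<Rightarrow> real) \<times> (site \<Rightarrow> site \<Rightarrow> real). fst p x y) \<in> borel_measurable (borel \<Otimes>\<^sub>M borel)"
    "(\<lambda>p :: (site \<Rightarrow> site \<Rightarrow> real) \<times> (site \<Rightarrow> site \<Rightarrow> real). snd p x y) \<in> borel_measurable (borel \<Otimes>\<^sub>M borel)"
    for x y
    by (rule measurable_compose[OF measurable_fst measurable_two_site_apply]
        measurable_compose[OF measurable_snd measurable_two_site_apply])+
  have inv\<nu>: "distr \<nu> (borel \<Otimes>\<^sub>M borel) (\<lambda>p. (translate z (fst p), translate z (snd p))) = \<nu>" for z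
    using invQ[of z] unfolding \<nu>_def q_def[symmetric] by (simp add: distr_distr comp_def)
  have marg1: "distr \<nu> borel fst = L"
  proof -
    have "distr \<nu> borel fst = distr (L \<Otimes>\<^sub>M unit_interval) borel fst"
      unfolding \<nu>_def by (simp add: distr_distr comp_def)
    also have "\<dots> = distr (L \<Otimes>\<^sub>M unit_interval) L fst" by (rule distr_cong) (simp_all add: setsL)
    also have "\<dots> = L" by (rule U.distr_pair_fst)
    finally show ?thesis .
  qed
  have marg2: "distr \<nu> borel snd = L"
    using margQ unfolding \<nu>_def q_def[symmetric] by (simp add: distr_distr comp_def)
  have ordered: "AE p in \<nu>. (\<forall>x. fst p x (x + e) \<le> snd p x (x + e)) \<or> (\<forall>x. snd p x (x + e) \<le> fst p x (x + e))"
    if e: "e = e1 \<or> e = e2" for e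
  proof -
    have ord: "{p \<in> space (borel \<Otimes>\<^sub>M borel). (\<forall>x. fst p x (x + e) \<le> snd p x (x + e)) \<or> (\<forall>x. snd p x (x + e) \<le> (fst p :: site \<Rightarrow> site \<Rightarrow> real) x (x + e))} \<in> sets (borel \<Otimes>\<^sub>M borel)"
      by (intro sets.sets_Collect_disj sets.sets_Collect_countable_All borel_measurable_le edge_meas)
    show ?thesis
      unfolding \<nu>_def
    proof (subst AE_distr_iff[OF _ ord])
      show "AE p in L \<Otimes>\<^sub>M unit_interval. (\<forall>x. fst (fst p, q p) x (x + e) \<le> snd (fst p, q p) x (x + e)) \<or>
          (\<forall>x. snd (fst p, q p) x (x + e) \<le> fst (fst p, q p) x (x + e))"
        using good2 weightQ[folded q_def]
      proof eventually_elim
        case (elim p)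
        have "up_closed UNIV" by (simp add: up_closed_def)
        from increments_ordered[OF elim(1,2) this _ e] elim(3) show ?case by simp
      qed
    qed measurable
  qed
  have edges: "AE p in \<nu>. \<forall>x. fst p x (x + e) = snd p x (x + e)"
    if e: "e = e1 \<or> e = e2" and c: "AE w in M. real_cond_exp M (invariant_algebra M T) (\<lambda>w. Bh w 0 e) w = c" for e c
    by (rule edges_eq_of_ordered_coupling[OF L setsL invL intL meanL[OF _ _ _ c] _ inv\<nu> marg1 marg2 ordered[OF e]])
       (simp_all add: \<nu>_def)
  have c1: "AE w in M. real_cond_exp M (invariant_algebra M T) (\<lambda>w. Bh w 0 e1) w = - fst h"
    and c2: "AE w in M. real_cond_exp M (invariant_algebra M T) (\<lambda>w. Bh w 0 e2) w = - snd h"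
    using mean by (auto simp: mean_vec_def elim!: eventually_mono)
  have "AE p in \<nu>. (\<forall>x. fst p x (x + e1) = snd p x (x + e1)) \<and> (\<forall>x. fst p x (x + e2) = snd p x (x + e2))"
    using edges[OF _ c1] edges[OF _ c2] by simp
  then have "AE p in L \<Otimes>\<^sub>M unit_interval. (\<forall>x. fst (fst p, q p) x (x + e1) = snd (fst p, q p) x (x + e1)) \<and>
      (\<forall>x. fst (fst p, q p) x (x + e2) = snd (fst p, q p) x (x + e2))"
    unfolding \<nu>_def by (rule AE_distrD[rotated]) measurable
  then have "AE p in L \<Otimes>\<^sub>M unit_interval. fst p = Q (weight_of (fst p), snd p)"
    using good2
  proof eventually_elim
    case (elim p)
    then have co: "cocycle (fst p)" "cocycle (q p)" by (auto simp: coalescing_def)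
    have "fst p x y = q p x y" for x y
      by (rule cocycle_eq_if_edges_eq[OF co, of e1 e2 UNIV]) (use elim in auto)
    then have "fst p = q p" by (intro ext)
    then show ?case by (simp add: q_def)
  qed
  from AE_pair_fix_snd[OF L prob_space_unit_interval this]
  \<comment> \<open>Fixing the noise turns the copy into a function of the weights alone.\<close>
  obtain u where u: "AE b in L. b = Q (weight_of b, u)" by blast
  show ?thesis
  proof (rule that)
    show "(\<lambda>\<omega>. Q (\<omega>, u)) \<in> borel_measurable borel" by measurable
    show "AE w in M. Bh w = Q (\<lambda>x. W x w, u)"
      using AE_distrD[OF Bh_meas u[unfolded L_def]] weight by eventually_elim simp
  qed
qed

section \<open>Resampling the weights off a set of sites\<close>

text \<open>
  The configuration that keeps the first component on \<open>H\<close> and takes the second component off \<open>H\<close>.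
\<close>

definition resample :: "site set \<Rightarrow> (site \<Rightarrow> real) \<times> (site \<Rightarrow> real) \<Rightarrow> site \<Rightarrow> real" where
  "resample H p = (\<lambda>x. if x \<in> H then fst p x else snd p x)"

lemma measurable_resample[measurable]: "resample H \<in> borel_measurable (borel \<Otimes>\<^sub>M borel)"
proof (rule measurable_coordinatewise_then_product)
  fix x
  have "(\<lambda>p :: (site \<Rightarrow> real) \<times> (site \<Rightarrow> real). fst p x) \<in> borel_measurable (borel \<Otimes>\<^sub>M borel)"
    "(\<lambda>p :: (site \<Rightarrow> real) \<times> (site \<Rightarrow> real). snd p x) \<in> borel_measurable (borel \<Otimes>\<^sub>M borel)"
    by (rule measurable_compose[OF measurable_fst measurable_product_coordinates]
        measurable_compose[OF measurable_snd measurable_product_coordinates])+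
  then show "(\<lambda>p. resample H p x) \<in> borel_measurable (borel \<Otimes>\<^sub>M borel)"
    by (cases "x \<in> H") (simp_all add: resample_def)
qed

lemma distr_resample_PiM:
  fixes N :: "real measure"
  assumes N: "prob_space N" and setsN: "sets N = sets borel"
    and P: "P = PiM (UNIV :: site set) (\<lambda>_. N)"
  shows "distr (P \<Otimes>\<^sub>M P) borel (resample H) = P"
proof -
  interpret N: prob_space N by fact
  interpret PP: product_prob_space "\<lambda>_ :: site. N" UNIV ..
  interpret P: prob_space P unfolding P by (rule PP.prob_space_axioms)
  have setsP[measurable_cong]: "sets P = sets borel"
  proof -
    have "sets P = sets (PiM (UNIV :: site set) (\<lambda>_. borel :: real measure))"
      unfolding P by (rule sets_PiM_cong) (simp_all add: setsN)
    then show ?thesis by (simp add: sets_PiM_equal_borel)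
  qed
  have spP: "space P = UNIV" using setsP[THEN sets_eq_imp_space_eq] by simp
  have spN: "space N = UNIV" using setsN[THEN sets_eq_imp_space_eq] by simp
  show ?thesis
    unfolding P
  proof (rule PP.PiM_eq)
    show "sets (distr (PiM UNIV (\<lambda>_. N) \<Otimes>\<^sub>M PiM UNIV (\<lambda>_. N)) borel (resample H)) = sets (PiM (UNIV :: site set) (\<lambda>_. N))"
      using setsP by (simp add: P)
  next
    fix J and F :: "site \<Rightarrow> real set"
    assume J: "finite J" and F: "\<And>j. j \<in> J \<Longrightarrow> F j \<in> sets N"
    define X where "X K = {\<omega> \<in> space P. \<forall>j\<in>K. \<omega> j \<in> F j}" for K
    have X: "X K \<in> sets borel" "emeasure P (X K) = (\<Prod>j\<in>K. emeasure N (F j))" if "K \<subseteq> J" for K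
    proof -
      have K: "finite K" "\<And>j. j \<in> K \<Longrightarrow> F j \<in> sets N" using that J F by (auto intro: finite_subset)
      then show "emeasure P (X K) = (\<Prod>j\<in>K. emeasure N (F j))"
        unfolding X_def P by (intro PP.emeasure_PiM_Collect) auto
      have "X K \<in> sets P"
        unfolding X_def P using K by (intro sets.sets_Collect_finite_All) (auto simp: P)
      then show "X K \<in> sets borel" by (simp add: setsP)
    qed
    have "prod_emb UNIV (\<lambda>_. N) J (\<Pi>\<^sub>E j\<in>J. F j) = X J"
      using F by (auto simp: prod_emb_def X_def spP spN PiE_iff)
    then have "emeasure (distr (P \<Otimes>\<^sub>M P) borel (resample H)) (prod_emb UNIV (\<lambda>_. N) J (\<Pi>\<^sub>E j\<in>J. F j))
        = emeasure (P \<Otimes>\<^sub>M P) (resample H -` X J \<inter> space (P \<Otimes>\<^sub>M P))"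
      using X(1)[of J] by (simp add: emeasure_distr)
    also have "resample H -` X J \<inter> space (P \<Otimes>\<^sub>M P) = X (J \<inter> H) \<times> X (J - H)"
      by (auto simp: X_def resample_def spP space_pair_measure)
    also have "emeasure (P \<Otimes>\<^sub>M P) \<dots> = (\<Prod>j\<in>J \<inter> H. emeasure N (F j)) * (\<Prod>j\<in>J - H. emeasure N (F j))"
      using X[of "J \<inter> H"] X[of "J - H"] by (subst P.emeasure_pair_measure_Times) (auto simp: setsP)
    also have "\<dots> = (\<Prod>j\<in>J. emeasure N (F j))"
      using J by (subst prod.Int_Diff[of J _ H]) auto
    finally show "emeasure (distr (PiM UNIV (\<lambda>_. N) \<Otimes>\<^sub>M PiM UNIV (\<lambda>_. N)) borel (resample H))
        (prod_emb UNIV (\<lambda>_. N) J (\<Pi>\<^sub>E j\<in>J. F j)) = (\<Prod>j\<in>J. emeasure N (F j))"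
      by (simp add: P)
  qed
qed

text \<open>
  As the sets on which the weights are kept exhaust the lattice, an integrable function of the
  weights is less and less affected by the resampling, in mean. Single-coordinate events are
  eventually unaffected; the general case follows by approximation.
\<close>

lemma resample_approximates:
  fixes P :: "(site \<Rightarrow> real) measure" and H :: "nat \<Rightarrow> site set"
  assumes P: "prob_space P" and setsP[measurable_cong]: "sets P = sets borel"
    and law: "\<And>k. distr (P \<Otimes>\<^sub>M P) borel (resample (H k)) = P"
    and H: "\<And>z. \<forall>\<^sub>F k in sequentially. z \<in> H k"
    and f: "integrable P f"
  shows "(\<lambda>k. \<integral>p. \<bar>f (fst p) - f (resample (H k) p)\<bar> \<partial>(P \<Otimes>\<^sub>M P)) \<longlonglongrightarrow> (0 :: real)"
proof -
  interpret P: prob_space P by fact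
  interpret PP: pair_prob_space P P ..
  have spP: "space P = UNIV" using setsP[THEN sets_eq_imp_space_eq] by simp
  have spPP: "space (P \<Otimes>\<^sub>M P) = UNIV" by (simp add: space_pair_measure spP)
  have fst_law: "distr (P \<Otimes>\<^sub>M P) borel fst = P"
  proof -
    have "distr (P \<Otimes>\<^sub>M P) borel fst = distr (P \<Otimes>\<^sub>M P) P fst" by (rule distr_cong) (simp_all add: setsP)
    then show ?thesis by (simp add: P.distr_pair_fst)
  qed
  have meas_law: "measure (P \<Otimes>\<^sub>M P) (fst -` X) = measure P X" "measure (P \<Otimes>\<^sub>M P) (resample (H k) -` X) = measure P X"
    "fst -` X \<in> sets (P \<Otimes>\<^sub>M P)" "resample (H k) -` X \<in> sets (P \<Otimes>\<^sub>M P)"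
    if [measurable]: "X \<in> sets borel" for X k
  proof -
    have "measure (distr (P \<Otimes>\<^sub>M P) borel fst) X = measure (P \<Otimes>\<^sub>M P) (fst -` X)"
      "measure (distr (P \<Otimes>\<^sub>M P) borel (resample (H k))) X = measure (P \<Otimes>\<^sub>M P) (resample (H k) -` X)"
      by (subst measure_distr; simp add: spPP)+
    then show "measure (P \<Otimes>\<^sub>M P) (fst -` X) = measure P X" "measure (P \<Otimes>\<^sub>M P) (resample (H k) -` X) = measure P X"
      unfolding fst_law law by simp_all
    have "fst -` X \<inter> space (P \<Otimes>\<^sub>M P) \<in> sets (P \<Otimes>\<^sub>M P)" "resample (H k) -` X \<inter> space (P \<Otimes>\<^sub>M P) \<in> sets (P \<Otimes>\<^sub>M P)"
      by (rule measurable_sets[OF _ that]; measurable)+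
    then show "fst -` X \<in> sets (P \<Otimes>\<^sub>M P)" "resample (H k) -` X \<in> sets (P \<Otimes>\<^sub>M P)" by (simp_all add: spPP)
  qed
  define \<Delta> where "\<Delta> k X = {p. (fst p \<in> X) \<noteq> (resample (H k) p \<in> X)}" for k X
  have \<Delta>_meas: "\<Delta> k X \<in> sets (P \<Otimes>\<^sub>M P)" if "X \<in> sets borel" for k X
  proof -
    have "\<Delta> k X = (fst -` X - resample (H k) -` X) \<union> (resample (H k) -` X - fst -` X)"
      by (auto simp: \<Delta>_def)
    then show ?thesis using meas_law(3,4)[OF that] by simp
  qed
  have borel_gen: "sets (borel :: (site \<Rightarrow> real) measure) = sigma_sets UNIV {{\<omega>. \<omega> i \<in> A} | i A. A \<in> sets borel}"
  proof -
    have "sets (borel :: (site \<Rightarrow> real) measure) = sets (PiM UNIV (\<lambda>_. borel))" by (rule sets_PiM_equal_borel[symmetric])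
    then show ?thesis unfolding sets_PiM_single by simp
  qed
  have event: "(\<lambda>k. measure (P \<Otimes>\<^sub>M P) (\<Delta> k X)) \<longlonglongrightarrow> 0" if "X \<in> sets borel" for X
    using that unfolding borel_gen
  proof (induction rule: sigma_sets.induct)
    case (Basic X)
    then obtain i A where X: "X = {\<omega>. \<omega> i \<in> A}" by blast
    have "\<forall>\<^sub>F k in sequentially. measure (P \<Otimes>\<^sub>M P) (\<Delta> k X) = 0"
      using H[of i] by eventually_elim (simp add: \<Delta>_def X resample_def)
    then show ?case by (rule tendsto_eventually)
  next
    case Empty
    then show ?case by (simp add: \<Delta>_def)
  next
    case (Compl X)
    have "\<Delta> k (UNIV - X) = \<Delta> k X" for k by (auto simp: \<Delta>_def)
    with Compl show ?case by simp
  next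
    case (Union a)
    have a: "a i \<in> sets borel" for i using Union(1)[of i] by (simp add: borel_gen)
    show ?case
    proof (rule tendstoI)
      fix \<epsilon> :: real assume "0 < \<epsilon>"
      define R where "R n = (\<Union>i. a i) - (\<Union>i<n. a i)" for n
      have R: "R n \<in> sets borel" for n using a by (auto simp: R_def)
      have "(\<lambda>n. measure P (R n)) \<longlonglongrightarrow> measure P (\<Inter>n. R n)"
      proof (rule P.finite_Lim_measure_decseq)
        show "decseq R" by (auto simp: decseq_def R_def)
      qed (use R in \<open>auto simp: setsP\<close>)
      moreover have "(\<Inter>n. R n) = {}" by (auto simp: R_def)
      ultimately have "(\<lambda>n. measure P (R n)) \<longlonglongrightarrow> 0" by simp
      then have "\<forall>\<^sub>F n in sequentially. measure P (R n) < \<epsilon> / 3" by (rule order_tendstoD) (use \<open>0 < \<epsilon>\<close> in simp)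
      then obtain n where n: "measure P (R n) < \<epsilon> / 3" by (auto simp: eventually_sequentially)
      have bound: "measure (P \<Otimes>\<^sub>M P) (\<Delta> k (\<Union>i. a i)) \<le> (\<Sum>i<n. measure (P \<Otimes>\<^sub>M P) (\<Delta> k (a i))) + 2 * measure P (R n)" for k
      proof -
        have sub: "\<Delta> k (\<Union>i. a i) \<subseteq> (\<Union>i<n. \<Delta> k (a i)) \<union> (fst -` R n \<union> resample (H k) -` R n)"
          by (auto simp: \<Delta>_def R_def)
        have D: "(\<Union>i<n. \<Delta> k (a i)) \<in> sets (P \<Otimes>\<^sub>M P)" using \<Delta>_meas[OF a] by auto
        have "measure (P \<Otimes>\<^sub>M P) (\<Delta> k (\<Union>i. a i))
            \<le> measure (P \<Otimes>\<^sub>M P) ((\<Union>i<n. \<Delta> k (a i)) \<union> (fst -` R n \<union> resample (H k) -` R n))"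
          using sub D meas_law(3,4)[OF R] by (intro PP.finite_measure_mono) auto
        also have "\<dots> \<le> measure (P \<Otimes>\<^sub>M P) (\<Union>i<n. \<Delta> k (a i)) + measure (P \<Otimes>\<^sub>M P) (fst -` R n \<union> resample (H k) -` R n)"
          using D meas_law(3,4)[OF R] by (intro measure_Un_le) auto
        also have "measure (P \<Otimes>\<^sub>M P) (fst -` R n \<union> resample (H k) -` R n) \<le> measure P (R n) + measure P (R n)"
          using measure_Un_le[of "fst -` R n" "P \<Otimes>\<^sub>M P" "resample (H k) -` R n"] meas_law[OF R] by simp
        also have "measure (P \<Otimes>\<^sub>M P) (\<Union>i<n. \<Delta> k (a i)) \<le> (\<Sum>i<n. measure (P \<Otimes>\<^sub>M P) (\<Delta> k (a i)))"
          using \<Delta>_meas[OF a] by (intro measure_UNION_le) auto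
        finally show ?thesis by simp
      qed
      have "(\<lambda>k. \<Sum>i<n. measure (P \<Otimes>\<^sub>M P) (\<Delta> k (a i))) \<longlonglongrightarrow> (\<Sum>i<n. 0)"
        by (intro tendsto_sum Union)
      then have "\<forall>\<^sub>F k in sequentially. (\<Sum>i<n. measure (P \<Otimes>\<^sub>M P) (\<Delta> k (a i))) < \<epsilon> / 3"
        using \<open>0 < \<epsilon>\<close> by (intro order_tendstoD) auto
      then show "\<forall>\<^sub>F k in sequentially. dist (measure (P \<Otimes>\<^sub>M P) (\<Delta> k (\<Union>i. a i))) 0 < \<epsilon>"
      proof eventually_elim
        case (elim k)
        then show ?case using bound[of k] n by simp
      qed
    qed
  qed
  have int_fst: "integrable (P \<Otimes>\<^sub>M P) (\<lambda>p. g (fst p))" "(\<integral>p. g (fst p) \<partial>(P \<Otimes>\<^sub>M P)) = (\<integral>\<omega>. g \<omega> \<partial>P)"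
    and int_res: "integrable (P \<Otimes>\<^sub>M P) (\<lambda>p. g (resample (H k) p))" "(\<integral>p. g (resample (H k) p) \<partial>(P \<Otimes>\<^sub>M P)) = (\<integral>\<omega>. g \<omega> \<partial>P)"
    if "integrable P g" for g :: "(site \<Rightarrow> real) \<Rightarrow> real" and k
  proof -
    have [measurable]: "g \<in> borel_measurable borel"
      using borel_measurable_integrable[OF that] by measurable
    show "integrable (P \<Otimes>\<^sub>M P) (\<lambda>p. g (fst p))"
      by (rule integrable_distr[where M'=borel and T=fst and f=g]) (simp_all add: fst_law that)
    show "integrable (P \<Otimes>\<^sub>M P) (\<lambda>p. g (resample (H k) p))"
      by (rule integrable_distr[where M'=borel and T="resample (H k)" and f=g]) (simp_all add: law that)
    show "(\<integral>p. g (fst p) \<partial>(P \<Otimes>\<^sub>M P)) = (\<integral>\<omega>. g \<omega> \<partial>P)"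
      by (subst integral_distr[where N=borel and g=fst and f=g, symmetric]) (simp_all add: fst_law)
    show "(\<integral>p. g (resample (H k) p) \<partial>(P \<Otimes>\<^sub>M P)) = (\<integral>\<omega>. g \<omega> \<partial>P)"
      by (subst integral_distr[where N=borel and g="resample (H k)" and f=g, symmetric]) (simp_all add: law)
  qed
  define osc where "osc g k = (\<integral>p. \<bar>g (fst p) - g (resample (H k) p)\<bar> \<partial>(P \<Otimes>\<^sub>M P))" for g :: "(site \<Rightarrow> real) \<Rightarrow> real" and k
  have osc_add: "osc (\<lambda>\<omega>. g \<omega> + g' \<omega>) k \<le> osc g k + osc g' k" if "integrable P g" "integrable P g'" for g g' k
  proof -
    have "osc (\<lambda>\<omega>. g \<omega> + g' \<omega>) k \<le> (\<integral>p. \<bar>g (fst p) - g (resample (H k) p)\<bar> + \<bar>g' (fst p) - g' (resample (H k) p)\<bar> \<partial>(P \<Otimes>\<^sub>M P))"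
      unfolding osc_def using int_fst(1)[OF that(1)] int_fst(1)[OF that(2)] int_res(1)[OF that(1)] int_res(1)[OF that(2)]
      by (intro integral_mono) auto
    also have "\<dots> = osc g k + osc g' k"
      unfolding osc_def using int_fst(1)[OF that(1)] int_fst(1)[OF that(2)] int_res(1)[OF that(1)] int_res(1)[OF that(2)]
      by (intro Bochner_Integration.integral_add) auto
    finally show ?thesis .
  qed
  have osc_le: "osc g k \<le> 2 * (\<integral>\<omega>. \<bar>g \<omega>\<bar> \<partial>P)" if g: "integrable P g" for g k
  proof -
    have g': "integrable P (\<lambda>\<omega>. \<bar>g \<omega>\<bar>)" using g by simp
    have "osc g k \<le> (\<integral>p. \<bar>g (fst p)\<bar> + \<bar>g (resample (H k) p)\<bar> \<partial>(P \<Otimes>\<^sub>M P))"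
      unfolding osc_def using int_fst(1)[OF g] int_res(1)[OF g] by (intro integral_mono) auto
    also have "\<dots> = 2 * (\<integral>\<omega>. \<bar>g \<omega>\<bar> \<partial>P)"
      using int_fst[OF g'] int_res[OF g'] by simp
    finally show ?thesis .
  qed
  have osc_nonneg: "0 \<le> osc g k" for g k by (simp add: osc_def)
  have "osc f \<longlonglongrightarrow> 0"
    using f
  proof (induction rule: integrable_induct)
    case (base A c)
    then have A: "A \<in> sets borel" by (simp add: setsP)
    have "osc (\<lambda>\<omega>. indicator A \<omega> *\<^sub>R c) = (\<lambda>k. \<bar>c\<bar> * measure (P \<Otimes>\<^sub>M P) (\<Delta> k A))"
    proof
      fix k
      have "osc (\<lambda>\<omega>. indicator A \<omega> *\<^sub>R c) k = (\<integral>p. \<bar>c\<bar> * indicator (\<Delta> k A) p \<partial>(P \<Otimes>\<^sub>M P))"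
        unfolding osc_def by (intro Bochner_Integration.integral_cong) (auto simp: \<Delta>_def split: split_indicator)
      also have "\<dots> = \<bar>c\<bar> * measure (P \<Otimes>\<^sub>M P) (\<Delta> k A)" using \<Delta>_meas[OF A] by (simp add: spPP)
      finally show "osc (\<lambda>\<omega>. indicator A \<omega> *\<^sub>R c) k = \<bar>c\<bar> * measure (P \<Otimes>\<^sub>M P) (\<Delta> k A)" .
    qed
    then show ?case using tendsto_mult_left[OF event[OF A], of "\<bar>c\<bar>"] by simp
  next
    case (add g g')
    show ?case
    proof (rule tendsto_sandwich[where f="\<lambda>_. 0"])
      show "(\<lambda>k. osc g k + osc g' k) \<longlonglongrightarrow> 0" using tendsto_add[OF add(3,4)] add by (auto intro: tendsto_add_zero)
      show "\<forall>\<^sub>F k in sequentially. osc (\<lambda>\<omega>. g \<omega> + g' \<omega>) k \<le> osc g k + osc g' k"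
        using osc_add add by simp
    qed (auto simp: osc_nonneg)
  next
    case (lim g s)
    have s_int: "\<And>i. integrable P (s i)" and s_osc: "\<And>i. osc (s i) \<longlonglongrightarrow> 0"
      and s_lim: "\<And>\<omega>. \<omega> \<in> space P \<Longrightarrow> (\<lambda>i. s i \<omega>) \<longlonglongrightarrow> g \<omega>"
      and s_bound: "\<And>i \<omega>. \<omega> \<in> space P \<Longrightarrow> norm (s i \<omega>) \<le> 2 * norm (g \<omega>)" and g_int: "integrable P g"
      by (fact lim)+
    have "(\<lambda>i. \<integral>\<omega>. \<bar>g \<omega> - s i \<omega>\<bar> \<partial>P) \<longlonglongrightarrow> (\<integral>\<omega>. 0 \<partial>P)"
    proof (rule integral_dominated_convergence[where w="\<lambda>\<omega>. 3 * \<bar>g \<omega>\<bar>"])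
      show "AE \<omega> in P. (\<lambda>i. \<bar>g \<omega> - s i \<omega>\<bar>) \<longlonglongrightarrow> 0"
      proof (rule AE_I2)
        fix \<omega> assume "\<omega> \<in> space P"
        from tendsto_rabs[OF tendsto_diff[OF tendsto_const[of "g \<omega>"] s_lim[OF this]]]
        show "(\<lambda>i. \<bar>g \<omega> - s i \<omega>\<bar>) \<longlonglongrightarrow> 0" by simp
      qed
      show "AE \<omega> in P. norm \<bar>g \<omega> - s i \<omega>\<bar> \<le> 3 * \<bar>g \<omega>\<bar>" for i
        using s_bound by (intro AE_I2) (smt (verit) real_norm_def)
    qed (use s_int g_int in auto)
    then have L1: "(\<lambda>i. \<integral>\<omega>. \<bar>g \<omega> - s i \<omega>\<bar> \<partial>P) \<longlonglongrightarrow> 0" by simp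
    show ?case
    proof (rule tendstoI)
      fix \<epsilon> :: real assume "0 < \<epsilon>"
      have "\<forall>\<^sub>F i in sequentially. (\<integral>\<omega>. \<bar>g \<omega> - s i \<omega>\<bar> \<partial>P) < \<epsilon> / 4"
        by (rule order_tendstoD(2)[OF L1]) (use \<open>0 < \<epsilon>\<close> in simp)
      then obtain i where i: "(\<integral>\<omega>. \<bar>g \<omega> - s i \<omega>\<bar> \<partial>P) < \<epsilon> / 4" by (auto simp: eventually_sequentially)
      have d: "integrable P (\<lambda>\<omega>. g \<omega> - s i \<omega>)" using s_int g_int by auto
      have "\<forall>\<^sub>F k in sequentially. osc (s i) k < \<epsilon> / 2"
        by (rule order_tendstoD(2)[OF s_osc]) (use \<open>0 < \<epsilon>\<close> in simp)
      then show "\<forall>\<^sub>F k in sequentially. dist (osc g k) 0 < \<epsilon>"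
      proof eventually_elim
        case (elim k)
        have "osc g k \<le> osc (s i) k + osc (\<lambda>\<omega>. g \<omega> - s i \<omega>) k"
          using osc_add[OF s_int[of i] d, of k] by simp
        also have "\<dots> < \<epsilon>" using elim i osc_le[OF d, of k] by simp
        finally show ?case using osc_nonneg[of g k] by simp
      qed
    qed
  qed
  then show ?thesis unfolding osc_def .
qed

section \<open>Dependence on the forward weights only\<close>

text \<open>
  The inner normal of the half-plane \<open>H\<close> is \<open>e\<close>, and \<open>H\<close> is invariant under shifts along \<open>e'\<close> in both directions.
\<close>

lemma resample_invariance_half_plane:
  fixes P :: "(site \<Rightarrow> real) measure" and F :: "(site \<Rightarrow> real) \<Rightarrow> site \<Rightarrow> site \<Rightarrow> real"
  assumes P: "prob_space P" and setsP[measurable_cong]: "sets P = sets borel"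
    and law: "\<And>H. distr (P \<Otimes>\<^sub>M P) borel (resample H) = P"
    and invP: "\<And>z. distr P borel (canonical_shift z) = P"
    and F[measurable]: "F \<in> borel_measurable borel"
    and good: "AE \<omega> in P. coalescing (F \<omega>)" and weight: "AE \<omega> in P. weight_of (F \<omega>) = \<omega>"
    and cov: "\<And>z. AE \<omega> in P. F (canonical_shift z \<omega>) = translate z (F \<omega>)"
    and int: "\<And>x y. integrable P (\<lambda>\<omega>. F \<omega> x y)"
    and e: "(e, e') = (e1, e2) \<or> (e, e') = (e2, e1)"
    and H: "H = {x. c \<le> fst e * fst x + snd e * snd x}"
  shows "AE p in P \<Otimes>\<^sub>M P. \<forall>x\<in>H. \<forall>y\<in>H. F (fst p) x y = F (resample H p) x y"
proof -
  interpret P: prob_space P by fact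
  interpret PP: pair_prob_space P P ..
  have spP: "space P = UNIV" using setsP[THEN sets_eq_imp_space_eq] by simp
  have spPP: "space (P \<Otimes>\<^sub>M P) = UNIV" by (simp add: space_pair_measure spP)
  have fst_law: "distr (P \<Otimes>\<^sub>M P) borel fst = P"
  proof -
    have "distr (P \<Otimes>\<^sub>M P) borel fst = distr (P \<Otimes>\<^sub>M P) P fst" by (rule distr_cong) (simp_all add: setsP)
    then show ?thesis by (simp add: P.distr_pair_fst)
  qed
  have AE_fst: "AE p in P \<Otimes>\<^sub>M P. R (fst p)" if "AE \<omega> in P. R \<omega>" for R
    by (rule AE_fst_pair[OF P P that])
  have AE_res: "AE p in P \<Otimes>\<^sub>M P. R (resample K p)" if "AE \<omega> in P. R \<omega>" for R K
  proof (rule AE_distrD[where P=R and M'=borel and f="resample K"])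
    show "AE \<omega> in distr (P \<Otimes>\<^sub>M P) borel (resample K). R \<omega>" unfolding law by (rule that)
  qed measurable
  define \<tau> where "\<tau> z p = (canonical_shift z (fst p), canonical_shift z (snd p))" for z and p :: "(site \<Rightarrow> real) \<times> (site \<Rightarrow> real)"
  have \<tau>_meas[measurable]: "\<tau> z \<in> measurable (borel \<Otimes>\<^sub>M borel) (borel \<Otimes>\<^sub>M borel)" for z
    unfolding \<tau>_def by measurable
  have \<tau>_law: "distr (P \<Otimes>\<^sub>M P) (borel \<Otimes>\<^sub>M borel) (\<tau> z) = P \<Otimes>\<^sub>M P" for z
  proof -
    have "distr P borel (canonical_shift z) \<Otimes>\<^sub>M distr P borel (canonical_shift z)
        = distr (P \<Otimes>\<^sub>M P) (borel \<Otimes>\<^sub>M borel) (\<lambda>(x, y). (canonical_shift z x, canonical_shift z y))"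
      by (rule pair_measure_distr) (simp_all add: invP P.sigma_finite_measure_axioms)
    then show ?thesis unfolding invP by (simp add: \<tau>_def[abs_def] case_prod_beta')
  qed
  have resample_shift: "resample K (\<tau> z p) = canonical_shift z (resample {x. x - z \<in> K} p)" for K z p
    by (auto simp: resample_def \<tau>_def canonical_shift_def fun_eq_iff)
  have H_inv: "x + e' \<in> H \<longleftrightarrow> x \<in> H" "x - e' \<in> H \<longleftrightarrow> x \<in> H" for x using e H by auto
  have H_up: "up_closed H" using e H by (auto simp: up_closed_def)
  have res_\<tau>: "resample H (\<tau> e' p) = canonical_shift e' (resample H p)" for p
    by (simp add: resample_shift H_inv)
  define b where "b p = F (fst p)" for p :: "(site \<Rightarrow> real) \<times> (site \<Rightarrow> real)"
  define b' where "b' p = F (resample H p)" for p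
  define D where "D p x y = b' p x y - b p x y" for p x y
  have b_meas[measurable]: "b \<in> borel_measurable (borel \<Otimes>\<^sub>M borel)" "b' \<in> borel_measurable (borel \<Otimes>\<^sub>M borel)"
    unfolding b_def b'_def by measurable
  have edge_meas[measurable]: "(\<lambda>p. b p x y) \<in> borel_measurable (borel \<Otimes>\<^sub>M borel)" "(\<lambda>p. b' p x y) \<in> borel_measurable (borel \<Otimes>\<^sub>M borel)" for x y
    by (rule measurable_compose[OF _ measurable_two_site_apply]; measurable)+
  have D_meas[measurable]: "(\<lambda>p. D p x y) \<in> borel_measurable (borel \<Otimes>\<^sub>M borel)" for x y
    unfolding D_def by measurable
  have good': "AE p in P \<Otimes>\<^sub>M P. coalescing (b p) \<and> coalescing (b' p)"
    using AE_fst[OF good] AE_res[OF good, of H] by eventually_elim (simp add: b_def b'_def)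
  have weight': "AE p in P \<Otimes>\<^sub>M P. \<forall>x\<in>H. weight_of (b p) x = weight_of (b' p) x"
    using AE_fst[OF weight] AE_res[OF weight, of H] by eventually_elim (simp add: b_def b'_def resample_def)
  have cov': "AE p in P \<Otimes>\<^sub>M P. b (\<tau> e' p) = translate e' (b p) \<and> b' (\<tau> e' p) = translate e' (b' p)"
    using AE_fst[OF cov[of e']] AE_res[OF cov[of e'], of H]
  proof eventually_elim
    case (elim p)
    moreover have "fst (\<tau> e' p) = canonical_shift e' (fst p)" by (simp add: \<tau>_def)
    ultimately show ?case by (simp add: b_def b'_def res_\<tau>)
  qed
  have D_int: "integrable (P \<Otimes>\<^sub>M P) (\<lambda>p. D p x y)" for x y
  proof -
    have [measurable]: "(\<lambda>\<omega>. F \<omega> x y) \<in> borel_measurable borel"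
      by (rule measurable_compose[OF F measurable_two_site_apply])
    have "integrable (P \<Otimes>\<^sub>M P) (\<lambda>p. b p x y)"
      unfolding b_def by (rule integrable_distr[where M'=borel and T=fst and f="\<lambda>\<omega>. F \<omega> x y"]) (simp_all add: fst_law int)
    moreover have "integrable (P \<Otimes>\<^sub>M P) (\<lambda>p. b' p x y)"
      unfolding b'_def by (rule integrable_distr[where M'=borel and T="resample H" and f="\<lambda>\<omega>. F \<omega> x y"]) (simp_all add: law int)
    ultimately show ?thesis unfolding D_def by simp
  qed
  have AD_int: "integrable (P \<Otimes>\<^sub>M P) (\<lambda>p. indicator A p * D p x y)" if "A \<in> sets (borel \<Otimes>\<^sub>M borel)" for A x y
  proof -
    have "A \<in> sets (P \<Otimes>\<^sub>M P)" using that sets_pair_measure_cong[OF setsP setsP] by simp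
    from integrable_mult_indicator[OF this D_int] show ?thesis by simp
  qed
  have far: "(\<lambda>k. \<integral>p. \<bar>D p (x + scale (int k) e) (x + scale (int k) e + e')\<bar> \<partial>(P \<Otimes>\<^sub>M P)) \<longlonglongrightarrow> 0" for x
  proof -
    define y where "y k = x + scale (int k) e" for k
    define Hk where "Hk k = {z. z + y k \<in> H}" for k
    define f where "f \<omega> = F \<omega> 0 e'" for \<omega>
    have f_meas[measurable]: "f \<in> borel_measurable borel"
      unfolding f_def by (rule measurable_compose[OF F measurable_two_site_apply])
    have "(\<lambda>k. \<integral>p. \<bar>f (fst p) - f (resample (Hk k) p)\<bar> \<partial>(P \<Otimes>\<^sub>M P)) \<longlonglongrightarrow> 0"
    proof (rule resample_approximates[OF P setsP law])
      fix z
      have "z \<in> Hk k" if "nat (c - (fst e * fst (z + x) + snd e * snd (z + x))) \<le> k" for k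
        using that e H by (auto simp: Hk_def y_def scale_def)
      then show "\<forall>\<^sub>F k in sequentially. z \<in> Hk k" unfolding eventually_sequentially by blast
    qed (simp add: f_def int)
    moreover have "(\<integral>p. \<bar>D p (y k) (y k + e')\<bar> \<partial>(P \<Otimes>\<^sub>M P)) = (\<integral>p. \<bar>f (fst p) - f (resample (Hk k) p)\<bar> \<partial>(P \<Otimes>\<^sub>M P))" for k
    proof -
      have "(\<integral>p. \<bar>D p (y k) (y k + e')\<bar> \<partial>(P \<Otimes>\<^sub>M P)) = (\<integral>p. \<bar>f (fst (\<tau> (y k) p)) - f (resample (Hk k) (\<tau> (y k) p))\<bar> \<partial>(P \<Otimes>\<^sub>M P))"
      proof (rule integral_cong_AE)
        show "AE p in P \<Otimes>\<^sub>M P. \<bar>D p (y k) (y k + e')\<bar> = \<bar>f (fst (\<tau> (y k) p)) - f (resample (Hk k) (\<tau> (y k) p))\<bar>"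
          using AE_fst[OF cov[of "y k"]] AE_res[OF cov[of "y k"], of H]
        proof eventually_elim
          case (elim p)
          have "resample (Hk k) (\<tau> (y k) p) = canonical_shift (y k) (resample H p)"
            by (simp add: resample_shift Hk_def)
          moreover have "fst (\<tau> (y k) p) = canonical_shift (y k) (fst p)" by (simp add: \<tau>_def)
          ultimately show ?case using elim
            by (simp add: f_def D_def b_def b'_def translate_def add.commute)
        qed
      qed measurable
      also have "\<dots> = (\<integral>p. \<bar>f (fst p) - f (resample (Hk k) p)\<bar> \<partial>distr (P \<Otimes>\<^sub>M P) (borel \<Otimes>\<^sub>M borel) (\<tau> (y k)))"
        by (subst integral_distr) auto
      finally show ?thesis unfolding \<tau>_law .
    qed
    ultimately show ?thesis by (simp add: y_def)
  qed
  have zero: "(\<integral>p. indicator A p * D p x (x + e') \<partial>(P \<Otimes>\<^sub>M P)) = 0"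
    if A[measurable]: "A \<in> sets (borel \<Otimes>\<^sub>M borel)" and A_inv: "AE p in P \<Otimes>\<^sub>M P. \<tau> e' p \<in> A \<longleftrightarrow> p \<in> A" and x: "x \<in> H" for A x
  proof -
    \<comment> \<open>\<open>G\<close> and \<open>G'\<close> are the mean differences of the \<open>e'\<close>- and \<open>e\<close>-increments on the event \<open>A\<close>.\<close>
    define G where "G y = (\<integral>p. indicator A p * D p y (y + e') \<partial>(P \<Otimes>\<^sub>M P))" for y
    define G' where "G' y = (\<integral>p. indicator A p * D p y (y + e) \<partial>(P \<Otimes>\<^sub>M P))" for y
    have G'_inv: "G' (y + e') = G' y" for y
    proof -
      have "G' y = (\<integral>p. indicator A p * D p y (y + e) \<partial>distr (P \<Otimes>\<^sub>M P) (borel \<Otimes>\<^sub>M borel) (\<tau> e'))"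
        unfolding \<tau>_law G'_def ..
      also have "\<dots> = (\<integral>p. indicator A (\<tau> e' p) * D (\<tau> e' p) y (y + e) \<partial>(P \<Otimes>\<^sub>M P))"
        by (subst integral_distr) auto
      also have "\<dots> = G' (y + e')"
        unfolding G'_def
      proof (rule integral_cong_AE)
        show "AE p in P \<Otimes>\<^sub>M P. indicator A (\<tau> e' p) * D (\<tau> e' p) y (y + e) = indicator A p * D p (y + e') (y + e' + e)"
          using A_inv cov'
        proof eventually_elim
          case (elim p)
          have eq: "y + e' + e = y + e + e'" by (simp add: add.assoc add.commute)
          show ?case unfolding eq using elim by (simp add: D_def translate_def indicator_def)
        qed
      qed measurable
      finally show ?thesis ..
    qed
    \<comment> \<open>Going around the unit square at \<open>y\<close>: the two \<open>e\<close>-edges contribute equally, by invariance along \<open>e'\<close>.\<close>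
    have G_step: "G (y + e) = G y" for y
    proof -
      have "G (y + e) - G y = (\<integral>p. indicator A p * D p (y + e) (y + e + e') - indicator A p * D p y (y + e') \<partial>(P \<Otimes>\<^sub>M P))"
        unfolding G_def using AD_int[OF A] by simp
      also have "\<dots> = (\<integral>p. indicator A p * D p (y + e') (y + e' + e) - indicator A p * D p y (y + e) \<partial>(P \<Otimes>\<^sub>M P))"
      proof (rule integral_cong_AE)
        show "AE p in P \<Otimes>\<^sub>M P. indicator A p * D p (y + e) (y + e + e') - indicator A p * D p y (y + e')
            = indicator A p * D p (y + e') (y + e' + e) - indicator A p * D p y (y + e)"
          using good'
        proof eventually_elim
          case (elim p)
          then have co: "cocycle (D p)"
            unfolding coalescing_def cocycle_def D_def by (metis (no_types, lifting) add_diff_add)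
          have eq: "y + e' + e = y + e + e'" by (simp add: add.assoc add.commute)
          have "D p (y + e) (y + e + e') - D p y (y + e') = D p (y + e') (y + e' + e) - D p y (y + e)"
            using cocycle_add[OF co, of y "y + e + e'" "y + e"] cocycle_add[OF co, of y "y + e + e'" "y + e'"]
            unfolding eq by simp
          then show ?case by (simp flip: right_diff_distrib)
        qed
      qed measurable
      also have "\<dots> = G' (y + e') - G' y"
        unfolding G'_def using AD_int[OF A] by simp
      finally show ?thesis using G'_inv by simp
    qed
    have G_const: "G (x + scale (int k) e) = G x" for k
    proof (induction k)
      case (Suc k)
      have "x + scale (int (Suc k)) e = (x + scale (int k) e) + e"
        by (simp add: scale_def prod_eq_iff algebra_simps)
      with Suc G_step[of "x + scale (int k) e"] show ?case by metis
    qed (simp add: scale_def flip: zero_prod_def)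
    have bound: "\<bar>G x\<bar> \<le> (\<integral>p. \<bar>D p (x + scale (int k) e) (x + scale (int k) e + e')\<bar> \<partial>(P \<Otimes>\<^sub>M P))" for k
    proof -
      have "\<bar>G (x + scale (int k) e)\<bar> \<le> (\<integral>p. \<bar>indicator A p * D p (x + scale (int k) e) (x + scale (int k) e + e')\<bar> \<partial>(P \<Otimes>\<^sub>M P))"
        unfolding G_def by (rule integral_abs_bound)
      also have "\<dots> \<le> (\<integral>p. \<bar>D p (x + scale (int k) e) (x + scale (int k) e + e')\<bar> \<partial>(P \<Otimes>\<^sub>M P))"
        using AD_int[OF A] D_int by (intro integral_mono) (auto split: split_indicator)
      finally show ?thesis unfolding G_const .
    qed
    have "\<bar>G x\<bar> \<le> 0"
      by (rule LIMSEQ_le_const[OF far[of x]]) (use bound in blast)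
    then show ?thesis by (simp add: G_def)
  qed
  define A where "A = {p. \<forall>x\<in>H. 0 \<le> D p x (x + e')}"
  define A' where "A' = {p. \<forall>x\<in>H. D p x (x + e') \<le> 0}"
  have A_meas: "A \<in> sets (borel \<Otimes>\<^sub>M borel)" "A' \<in> sets (borel \<Otimes>\<^sub>M borel)"
  proof -
    have "{p \<in> space (borel \<Otimes>\<^sub>M borel). \<forall>x\<in>H. 0 \<le> D p x (x + e')} \<in> sets (borel \<Otimes>\<^sub>M borel)"
      "{p \<in> space (borel \<Otimes>\<^sub>M borel). \<forall>x\<in>H. D p x (x + e') \<le> 0} \<in> sets (borel \<Otimes>\<^sub>M borel)"
      by (intro sets.sets_Collect_countable_Ball borel_measurable_le D_meas borel_measurable_const; simp)+
    then show "A \<in> sets (borel \<Otimes>\<^sub>M borel)" "A' \<in> sets (borel \<Otimes>\<^sub>M borel)"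
      by (simp_all add: A_def A'_def space_pair_measure)
  qed
  have ball_shift: "(\<forall>x\<in>H. R (x + e')) \<longleftrightarrow> (\<forall>x\<in>H. R x)" for R
    by (metis H_inv diff_add_cancel)
  have A_inv: "AE p in P \<Otimes>\<^sub>M P. \<tau> e' p \<in> A \<longleftrightarrow> p \<in> A" "AE p in P \<Otimes>\<^sub>M P. \<tau> e' p \<in> A' \<longleftrightarrow> p \<in> A'"
  proof -
    have *: "AE p in P \<Otimes>\<^sub>M P. \<forall>x. D (\<tau> e' p) x (x + e') = D p (x + e') (x + e' + e')"
      using cov' by eventually_elim (simp add: D_def translate_def)
    show "AE p in P \<Otimes>\<^sub>M P. \<tau> e' p \<in> A \<longleftrightarrow> p \<in> A"
      using *
    proof eventually_elim
      case (elim p)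
      then show ?case unfolding A_def mem_Collect_eq using ball_shift[of "\<lambda>x. 0 \<le> D p x (x + e')"] by metis
    qed
    show "AE p in P \<Otimes>\<^sub>M P. \<tau> e' p \<in> A' \<longleftrightarrow> p \<in> A'"
      using *
    proof eventually_elim
      case (elim p)
      then show ?case unfolding A'_def mem_Collect_eq using ball_shift[of "\<lambda>x. D p x (x + e') \<le> 0"] by metis
    qed
  qed
  have eqA: "AE p in P \<Otimes>\<^sub>M P. p \<in> A \<longrightarrow> D p x (x + e') = 0" if x: "x \<in> H" for x
  proof -
    have "AE p in P \<Otimes>\<^sub>M P. indicator A p * D p x (x + e') = 0"
      using zero[OF A_meas(1) A_inv(1) x] AD_int[OF A_meas(1), of x "x + e'"] x
      by (subst (asm) integral_nonneg_eq_0_iff_AE) (auto simp: A_def split: split_indicator)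
    then show ?thesis by eventually_elim auto
  qed
  have eqA': "AE p in P \<Otimes>\<^sub>M P. p \<in> A' \<longrightarrow> D p x (x + e') = 0" if x: "x \<in> H" for x
  proof -
    have "(\<integral>p. - (indicator A' p * D p x (x + e')) \<partial>(P \<Otimes>\<^sub>M P)) = 0"
      using zero[OF A_meas(2) A_inv(2) x] by simp
    moreover have "integrable (P \<Otimes>\<^sub>M P) (\<lambda>p. - (indicator A' p * D p x (x + e')))"
      using AD_int[OF A_meas(2), of x "x + e'"] by simp
    ultimately have "AE p in P \<Otimes>\<^sub>M P. - (indicator A' p * D p x (x + e')) = 0"
      using x by (subst (asm) integral_nonneg_eq_0_iff_AE) (auto simp: A'_def split: split_indicator)
    then show ?thesis by eventually_elim auto
  qed
  have "AE p in P \<Otimes>\<^sub>M P. \<forall>x\<in>H. p \<in> A \<longrightarrow> D p x (x + e') = 0" "AE p in P \<Otimes>\<^sub>M P. \<forall>x\<in>H. p \<in> A' \<longrightarrow> D p x (x + e') = 0"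
    by (rule AE_ball_countable[THEN iffD2], simp, intro ballI eqA eqA', assumption)+
  then show ?thesis
    using good' weight'
  proof eventually_elim
    case (elim p)
    have e'_cases: "e' = e1 \<or> e' = e2" using e by auto
    from elim(3) have gb: "coalescing (b p)" "coalescing (b' p)" by auto
    have w: "\<And>y. y \<in> H \<Longrightarrow> weight_of (b p) y = weight_of (b' p) y" using elim(4) by blast
    have "p \<in> A \<or> p \<in> A'"
      using increments_ordered[OF gb H_up w e'_cases] by (simp add: A_def A'_def D_def)
    with elim(1,2) have "\<And>x. x \<in> H \<Longrightarrow> b p x (x + e') = b' p x (x + e')" by (auto simp: D_def)
    from eq_of_transverse_increments_eq[OF gb e H w this] show ?case by (simp add: b_def b'_def)
  qed
qed

text \<open>
  The quadrant is the intersection of two half-planes. The weights are resampled off one of them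
  and then off the other, and Fubini's theorem provides values \<open>\<zeta>\<close> at which the resampled weights can be frozen.
\<close>

lemma quadrant_version:
  fixes P :: "(site \<Rightarrow> real) measure" and F :: "(site \<Rightarrow> real) \<Rightarrow> site \<Rightarrow> site \<Rightarrow> real"
  assumes P: "prob_space P" and setsP[measurable_cong]: "sets P = sets borel"
    and law: "\<And>H. distr (P \<Otimes>\<^sub>M P) borel (resample H) = P"
    and invP: "\<And>z. distr P borel (canonical_shift z) = P"
    and F[measurable]: "F \<in> borel_measurable borel"
    and good: "AE \<omega> in P. coalescing (F \<omega>)" and weight: "AE \<omega> in P. weight_of (F \<omega>) = \<omega>"
    and cov: "\<And>z. AE \<omega> in P. F (canonical_shift z \<omega>) = translate z (F \<omega>)"
    and int: "\<And>x y. integrable P (\<lambda>\<omega>. F \<omega> x y)"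
    and xy: "x \<in> quadrant u" "y \<in> quadrant u"
  shows "\<exists>\<zeta>. AE \<omega> in P. F \<omega> x y = F (resample (quadrant u) (\<omega>, \<zeta>)) x y"
proof -
  interpret P: prob_space P by fact
  interpret PP: pair_prob_space P P ..
  interpret PPP: pair_prob_space "P \<Otimes>\<^sub>M P" P ..
  define H1 where "H1 = {z :: site. fst u \<le> fst z}"
  define H2 where "H2 = {z :: site. snd u \<le> snd z}"
  have in_H: "x \<in> H1" "y \<in> H1" "x \<in> H2" "y \<in> H2" using xy by (auto simp: H1_def H2_def quadrant_def)
  note half_plane = resample_invariance_half_plane[OF P setsP law invP F good weight cov int]
  have 1: "AE p in P \<Otimes>\<^sub>M P. F (fst p) x y = F (resample H1 p) x y"
  proof -
    have "AE p in P \<Otimes>\<^sub>M P. \<forall>x\<in>H1. \<forall>y\<in>H1. F (fst p) x y = F (resample H1 p) x y"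
      by (rule half_plane[of e1 e2 H1 "fst u"]) (auto simp: H1_def)
    then show ?thesis by eventually_elim (use in_H in blast)
  qed
  have 2: "AE p in P \<Otimes>\<^sub>M P. F (fst p) x y = F (resample H2 p) x y"
  proof -
    have "AE p in P \<Otimes>\<^sub>M P. \<forall>x\<in>H2. \<forall>y\<in>H2. F (fst p) x y = F (resample H2 p) x y"
      by (rule half_plane[of e2 e1 H2 "snd u"]) (auto simp: H2_def)
    then show ?thesis by eventually_elim (use in_H in blast)
  qed
  have law3: "distr ((P \<Otimes>\<^sub>M P) \<Otimes>\<^sub>M P) (borel \<Otimes>\<^sub>M P) (\<lambda>t. (resample H2 (fst t), snd t)) = P \<Otimes>\<^sub>M P"
  proof -
    have "distr (P \<Otimes>\<^sub>M P) borel (resample H2) \<Otimes>\<^sub>M distr P P (\<lambda>x. x)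
        = distr ((P \<Otimes>\<^sub>M P) \<Otimes>\<^sub>M P) (borel \<Otimes>\<^sub>M P) (\<lambda>(x, y). (resample H2 x, y))"
      by (rule pair_measure_distr) (simp_all add: P.sigma_finite_measure_axioms)
    then show ?thesis unfolding law by (simp add: case_prod_beta')
  qed
  have "AE t in (P \<Otimes>\<^sub>M P) \<Otimes>\<^sub>M P. F (resample H2 (fst t)) x y = F (resample H1 (resample H2 (fst t), snd t)) x y"
  proof -
    have "AE p in distr ((P \<Otimes>\<^sub>M P) \<Otimes>\<^sub>M P) (borel \<Otimes>\<^sub>M P) (\<lambda>t. (resample H2 (fst t), snd t)). F (fst p) x y = F (resample H1 p) x y"
      unfolding law3 by (rule 1)
    then have "AE t in (P \<Otimes>\<^sub>M P) \<Otimes>\<^sub>M P. F (fst (resample H2 (fst t), snd t)) x y = F (resample H1 (resample H2 (fst t), snd t)) x y"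
      by (rule AE_distrD[rotated]) measurable
    then show ?thesis by simp
  qed
  moreover have "AE t in (P \<Otimes>\<^sub>M P) \<Otimes>\<^sub>M P. F (fst (fst t)) x y = F (resample H2 (fst t)) x y"
    by (rule AE_fst_pair[OF PP.prob_space_axioms P 2])
  ultimately have "AE t in (P \<Otimes>\<^sub>M P) \<Otimes>\<^sub>M P. F (fst (fst t)) x y = F (resample H1 (resample H2 (fst t), snd t)) x y"
    by eventually_elim simp
  from AE_pair_fix_snd[OF PP.prob_space_axioms P this]
  obtain \<eta> where "AE p in P \<Otimes>\<^sub>M P. F (fst p) x y = F (resample H1 (resample H2 p, \<eta>)) x y" by blast
  then have "AE p in P \<Otimes>\<^sub>M P. F (fst p) x y = F (resample H1 (resample H2 (fst p, snd p), \<eta>)) x y" by simp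
  from AE_pair_fix_snd[OF P P this]
  obtain \<eta>' where \<eta>': "AE \<omega> in P. F \<omega> x y = F (resample H1 (resample H2 (\<omega>, \<eta>'), \<eta>)) x y" by blast
  have eq: "resample H1 (resample H2 (\<omega>, \<eta>'), \<eta>) = resample (quadrant u) (\<omega>, resample H1 (\<eta>', \<eta>))" for \<omega>
    by (auto simp: resample_def H1_def H2_def quadrant_def fun_eq_iff)
  show ?thesis using \<eta>'[unfolded eq] by (intro exI[of _ "resample H1 (\<eta>', \<eta>)"])
qed

lemma measurable_forward_resample:
  assumes "quadrant u \<subseteq> quadrant v"
  shows "(\<lambda>\<omega>. resample (quadrant u) (\<omega>, \<zeta>)) \<in> borel_measurable (forward_algebra v)"
proof (rule measurable_coordinatewise_then_product)
  fix x
  have "(\<lambda>\<omega>. \<omega> x) \<in> borel_measurable (forward_algebra v)" if x: "x \<in> quadrant v"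
  proof (rule measurableI)
    fix A :: "real set" assume A: "A \<in> sets borel"
    have "canonical_weight x -` A \<in> {canonical_weight y -` A | y A. y \<in> quadrant v \<and> A \<in> sets borel}"
      unfolding mem_Collect_eq
      by (rule exI[of _ x], rule exI[of _ A], intro conjI refl x A)
    then have "canonical_weight x -` A \<in> sets (forward_algebra v)"
      unfolding forward_algebra_def by simp
    moreover have "(\<lambda>\<omega>. \<omega> x) -` A \<inter> space (forward_algebra v) = canonical_weight x -` A"
      by (auto simp: forward_algebra_def space_measure_of_conv canonical_weight_def)
    ultimately show "(\<lambda>\<omega>. \<omega> x) -` A \<inter> space (forward_algebra v) \<in> sets (forward_algebra v)" by simp
  qed simp
  then show "(\<lambda>\<omega>. resample (quadrant u) (\<omega>, \<zeta>) x) \<in> borel_measurable (forward_algebra v)"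
    using assms by (cases "x \<in> quadrant u") (auto simp: resample_def)
qed

theorem theorem3p1:
  fixes M :: "'a::polish_space measure"
    and T :: "site \<Rightarrow> 'a \<Rightarrow> 'a"
    and W :: "site \<Rightarrow> 'a \<Rightarrow> real"
    and Bh :: "'a \<Rightarrow> site \<Rightarrow> site \<Rightarrow> real"
    and h :: "real \<times> real"
  assumes "extended_space M T W"
    and "Bh \<in> coalescing_cocycles M T W"
    and "h = (\<integral>w. mean_vec M T Bh w \<partial>M)"
    and "measure M {w \<in> space M. mean_vec M T Bh w = h} = 1"
  shows "\<exists>B \<in> forward_coalescing_cocycles (canonical_measure M W).
           AE w in M. \<forall>x y. Bh w x y = B (\<lambda>z. W z w) x y"
proof -
  interpret extended_space M T W by fact
  note Bh = \<open>Bh \<in> coalescing_cocycles M T W\<close>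
  have "AE w in M. mean_vec M T Bh w = h"
    using assms(4) AE_in_set_eq_1[of "{w \<in> space M. mean_vec M T Bh w = h}"] measure_notin_sets[of "{w \<in> space M. mean_vec M T Bh w = h}" M]
    by (cases "{w \<in> space M. mean_vec M T Bh w = h} \<in> sets M") (auto elim!: eventually_mono)
  then obtain F where F[measurable]: "F \<in> borel_measurable borel" and BF: "AE w in M. Bh w = F (\<lambda>x. W x w)"
    using cocycle_function_of_weights[OF Bh] by blast
  have coc: "AE w in M. cocycle (Bh w) \<and> recovers (Bh w) (\<lambda>x. W x w)"
    and shift: "AE w in M. \<forall>x y z. Bh w (x + z) (y + z) = Bh (T z w) x y"
    and intB: "\<And>x y. integrable M (\<lambda>w. Bh w x y)"
    and coal: "AE w in M. \<forall>u v. coalesce (geodesic (Bh w) u) (geodesic (Bh w) v)"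
    using Bh by (auto simp: coalescing_cocycles_def cocycles_def)
  define V where "V w = (\<lambda>x. W x w)" for w
  have V_meas[measurable]: "V \<in> borel_measurable M"
    unfolding V_def by (rule measurable_coordinatewise_then_product) (rule W_measurable)
  define P where "P = canonical_measure M W"
  have P_def': "P = distr M borel V" by (simp add: P_def canonical_measure_def V_def[abs_def])
  have setsP[measurable_cong]: "sets P = sets borel" by (simp add: P_def')
  have spP: "space P = UNIV" using setsP[THEN sets_eq_imp_space_eq] by simp
  have P: "prob_space P" unfolding P_def' by (rule prob_space_distr) measurable
  define N where "N = distr M borel (W 0)"
  have N: "prob_space N" unfolding N_def by (rule prob_space_distr) (rule W_measurable)
  have PiM: "P = PiM (UNIV :: site set) (\<lambda>_. N)"
  proof -
    have "distr M (PiM UNIV (\<lambda>_. borel)) (\<lambda>w. \<lambda>x\<in>UNIV. W x w) = PiM UNIV (\<lambda>x. distr M borel (W x))"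
      using W_indep by (subst (asm) indep_vars_iff_distr_eq_PiM) (auto intro: W_measurable)
    moreover have "distr M (PiM UNIV (\<lambda>_. borel)) (\<lambda>w. \<lambda>x\<in>UNIV. W x w) = P"
      unfolding P_def' by (rule distr_cong) (simp_all add: V_def sets_PiM_equal_borel restrict_UNIV)
    moreover have "distr M borel (W x) = N" for x unfolding N_def by (rule W_ident)
    ultimately show ?thesis by (simp only:)
  qed
  have law: "distr (P \<Otimes>\<^sub>M P) borel (resample H) = P" for H
    by (rule distr_resample_PiM[OF N _ PiM]) (simp add: N_def)
  have V_shift: "AE w in M. V (T z w) = canonical_shift z (V w)" for z
    using AE_W_shift[of z]
  proof eventually_elim
    case (elim w)
    then show ?case unfolding V_def canonical_shift_def by (intro ext) metis
  qed
  have invP: "distr P borel (canonical_shift z) = P" for z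
  proof -
    have "distr P borel (canonical_shift z) = distr M borel (\<lambda>w. canonical_shift z (V w))"
      unfolding P_def' by (subst distr_distr) (auto simp: comp_def)
    also have "\<dots> = distr M borel (\<lambda>w. V (T z w))"
      by (rule distr_cong_AE) (use V_shift[of z] in \<open>auto elim!: eventually_mono\<close>)
    also have "\<dots> = distr (distr M M (T z)) borel V"
      by (subst distr_distr) (auto simp: comp_def)
    finally show ?thesis unfolding T_invariant P_def' .
  qed
  have BF': "AE w in M. Bh w = F (V w)" using BF by (simp add: V_def)
  have good: "AE \<omega> in P. coalescing (F \<omega>)"
    unfolding P_def'
  proof (subst AE_distr_iff)
    show "AE w in M. coalescing (F (V w))"
      using BF' coc coal by eventually_elim (simp add: coalescing_def)
  qed measurable
  have weight: "AE \<omega> in P. weight_of (F \<omega>) = \<omega>"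
  proof -
    have wF: "(\<lambda>\<omega>. weight_of (F \<omega>) x) \<in> borel_measurable borel" for x
      by (rule measurable_compose[OF F measurable_product_then_coordinatewise[OF measurable_weight_of]])
    have "AE \<omega> in P. weight_of (F \<omega>) x = \<omega> x" for x
      unfolding P_def'
    proof (subst AE_distr_iff)
      show "AE w in M. weight_of (F (V w)) x = V w x"
        using BF' coc
      proof eventually_elim
        case (elim w)
        then have "min (Bh w x (x + e1)) (Bh w x (x + e2)) = W x w" unfolding recovers_def by blast
        with elim(1) show ?case by (simp add: weight_of_def V_def)
      qed
      show "{\<omega> \<in> space borel. weight_of (F \<omega>) x = \<omega> x} \<in> sets borel"
        by (rule borel_measurable_eq[OF wF measurable_product_coordinates])
    qed measurable
    then have "AE \<omega> in P. \<forall>x. weight_of (F \<omega>) x = \<omega> x" by (simp add: AE_all_countable)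
    then show ?thesis
    proof eventually_elim
      case (elim \<omega>)
      then show ?case by (intro ext) blast
    qed
  qed
  have F_edge[measurable]: "(\<lambda>\<omega>. F \<omega> x y) \<in> borel_measurable borel" for x y
    by (rule measurable_compose[OF F measurable_two_site_apply])
  have cov: "AE \<omega> in P. F (canonical_shift z \<omega>) = translate z (F \<omega>)" for z
  proof -
    have "AE \<omega> in P. F (canonical_shift z \<omega>) x y = translate z (F \<omega>) x y" for x y
      unfolding P_def'
    proof (subst AE_distr_iff)
      show "AE w in M. F (canonical_shift z (V w)) x y = translate z (F (V w)) x y"
        using BF' AE_T[OF BF', of z] V_shift[of z] shift
      proof eventually_elim
        case (elim w)
        have "F (canonical_shift z (V w)) x y = Bh (T z w) x y" using elim(2,3) by simp
        also have "\<dots> = Bh w (x + z) (y + z)" using elim(4) by metis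
        also have "\<dots> = translate z (F (V w)) x y" using elim(1) by (simp add: translate_def)
        finally show ?case .
      qed
      show "{\<omega> \<in> space borel. F (canonical_shift z \<omega>) x y = translate z (F \<omega>) x y} \<in> sets borel"
        unfolding translate_def
        by (rule borel_measurable_eq[OF measurable_compose[OF measurable_canonical_shift F_edge] F_edge])
    qed measurable
    then have "AE \<omega> in P. \<forall>x y. F (canonical_shift z \<omega>) x y = translate z (F \<omega>) x y" by (simp only: AE_all_countable) blast
    then show ?thesis
    proof eventually_elim
      case (elim \<omega>)
      then show ?case by (intro ext) blast
    qed
  qed
  have intF: "integrable P (\<lambda>\<omega>. F \<omega> x y)" for x y
  proof -
    have "integrable M (\<lambda>w. F (V w) x y)"
      by (rule integrable_cong_AE_imp[OF intB[of x y]]) (use BF' in \<open>auto elim!: eventually_mono intro: measurable_compose[OF V_meas F_edge]\<close>)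
    then show ?thesis unfolding P_def' by (subst integrable_distr_eq) auto
  qed
  \<comment> \<open>The smallest quadrant that contains both sites; measurability with respect to its weights
    implies forward measurability for every quadrant containing them.\<close>
  define corner where "corner x y = (min (fst x) (fst y), min (snd x) (snd y))" for x y :: site
  have corner: "x \<in> quadrant (corner x y)" "y \<in> quadrant (corner x y)" for x y
    by (auto simp: corner_def quadrant_def)
  have corner_sub: "quadrant (corner x y) \<subseteq> quadrant v" if "x \<in> quadrant v" "y \<in> quadrant v" for x y v
    using that by (auto simp: corner_def quadrant_def)
  define \<zeta> where "\<zeta> x y = (SOME \<zeta>. AE \<omega> in P. F \<omega> x y = F (resample (quadrant (corner x y)) (\<omega>, \<zeta>)) x y)" for x y
  have \<zeta>: "AE \<omega> in P. F \<omega> x y = F (resample (quadrant (corner x y)) (\<omega>, \<zeta> x y)) x y" for x y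
    unfolding \<zeta>_def by (rule someI_ex[where P="\<lambda>\<zeta>. AE \<omega> in P. F \<omega> x y = F (resample (quadrant (corner x y)) (\<omega>, \<zeta>)) x y"], rule quadrant_version[OF P setsP law invP F good weight cov intF corner])
  define B where "B \<omega> x y = F (resample (quadrant (corner x y)) (\<omega>, \<zeta> x y)) x y" for \<omega> x y
  have FB: "AE \<omega> in P. F \<omega> = B \<omega>"
  proof -
    have "AE \<omega> in P. \<forall>x y. F \<omega> x y = B \<omega> x y" unfolding AE_all_countable B_def using \<zeta> by blast
    then show ?thesis
    proof eventually_elim
      case (elim \<omega>)
      then show ?case by (intro ext) blast
    qed
  qed
  have forward: "forward_measurable B"
    unfolding forward_measurable_def B_def
    using measurable_compose[OF measurable_forward_resample[OF corner_sub] F_edge] by blast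
  have B_edge[measurable]: "(\<lambda>\<omega>. B \<omega> x y) \<in> borel_measurable borel" for x y
    unfolding B_def by (rule measurable_compose[OF _ F_edge]) measurable
  have "B \<in> cocycles P canonical_shift canonical_weight"
    unfolding cocycles_def
  proof (intro CollectI conjI allI)
    have "(\<lambda>t. B (fst t) (fst (snd t)) (snd (snd t))) \<in> borel_measurable (P \<Otimes>\<^sub>M count_space UNIV \<Otimes>\<^sub>M count_space UNIV)"
    proof (rule measurable_compose_countable[of "\<lambda>x t. B (fst t) x (snd (snd t))" _ _ "\<lambda>t. fst (snd t)"])
      fix x
      show "(\<lambda>t. B (fst t) x (snd (snd t))) \<in> borel_measurable (P \<Otimes>\<^sub>M (count_space UNIV :: site measure) \<Otimes>\<^sub>M count_space UNIV)"
        by (rule measurable_compose_countable[of "\<lambda>y t. B (fst t) x y" _ _ "\<lambda>t. snd (snd t)"])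
           (rule measurable_compose[OF _ B_edge], measurable)
    qed measurable
    then show "(\<lambda>(\<omega>, x, y). B \<omega> x y) \<in> borel_measurable (P \<Otimes>\<^sub>M count_space UNIV \<Otimes>\<^sub>M count_space UNIV)"
      by (simp add: case_prod_beta')
    show "AE \<omega> in P. cocycle (B \<omega>) \<and> recovers (B \<omega>) (\<lambda>x. canonical_weight x \<omega>)"
      using FB good weight
    proof eventually_elim
      case (elim \<omega>)
      then have w: "weight_of (B \<omega>) x = \<omega> x" for x by simp
      have "recovers (B \<omega>) (\<lambda>x. canonical_weight x \<omega>)"
        unfolding recovers_def canonical_weight_def by (intro allI w[unfolded weight_of_def])
      with elim show ?case by (simp add: coalescing_def)
    qed
    have "AE \<omega> in P. F (canonical_shift z \<omega>) = B (canonical_shift z \<omega>)" for z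
    proof (rule AE_distrD[where P="\<lambda>\<omega>. F \<omega> = B \<omega>" and M'=borel and f="canonical_shift z"])
      show "AE \<omega> in distr P borel (canonical_shift z). F \<omega> = B \<omega>" unfolding invP by (rule FB)
    qed measurable
    then have "AE \<omega> in P. \<forall>z. F (canonical_shift z \<omega>) = B (canonical_shift z \<omega>)" "AE \<omega> in P. \<forall>z. F (canonical_shift z \<omega>) = translate z (F \<omega>)"
      using cov unfolding AE_all_countable by blast+
    then show "AE \<omega> in P. \<forall>x y z. B \<omega> (x + z) (y + z) = B (canonical_shift z \<omega>) x y"
      using FB
    proof eventually_elim
      case (elim \<omega>)
      show ?case
      proof (intro allI)
        fix x y z
        have "B (canonical_shift z \<omega>) = translate z (B \<omega>)" using elim by metis
        then show "B \<omega> (x + z) (y + z) = B (canonical_shift z \<omega>) x y" by (simp add: translate_def)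
      qed
    qed
    show "integrable P (\<lambda>\<omega>. B \<omega> x y)" for x y
      by (rule integrable_cong_AE_imp[OF intF[of x y]]) (use FB in \<open>auto elim!: eventually_mono\<close>)
  qed
  moreover have "AE \<omega> in P. \<forall>u v. coalesce (geodesic (B \<omega>) u) (geodesic (B \<omega>) v)"
    using FB good by eventually_elim (simp add: coalescing_def)
  ultimately have "B \<in> forward_coalescing_cocycles P"
    using forward by (simp add: forward_coalescing_cocycles_def coalescing_cocycles_def forward_cocycles_def)
  moreover have "AE w in M. \<forall>x y. Bh w x y = B (\<lambda>z. W z w) x y"
    using BF' AE_distrD[OF V_meas FB[unfolded P_def']] by eventually_elim (simp add: V_def)
  ultimately show ?thesis unfolding P_def by blast
qed

end
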